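(* Let $(W,S)$ be a finite rank, right-angled Coxeter system, and let $\Gamma$ be the finite undirected simplicial graph with vertex set $S$ and edge set $\{(s,t)\in S\times S \mid m_{s,t}=2\}$. Then the following statements hold: (1) If $\Gamma$ contains no induced square, then there exists a constant $K>0$ such that $$\|P_i x P_j\|\le K\,C_q\,\|x\delta_e\|_2$$ for all $q\in\mathbb{R}_{>0}^{(W,S)}$, all $i,j,n\in\mathbb{N}$ and all $x\in\chi_n(\mathbb{C}_q[W])$, where $$C_q:=\max_{\Gamma_0\in\mathrm{Cliq}(\Gamma)}\ \prod_{t\in V\Gamma_0}|p_t(q)| .$$ (2) If $\Gamma$ contains an induced square and $q\in\mathbb{R}_{>0}^{(W,S)}$, then there is no constant $K>0$ such that $\|P_i x P_j\|\le K\|x\delta_e\|_2$ holds for all $i,j,n\in\mathbb{N}$ and all $x\in\chi_n(\mathbb{C}_q[W])$.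
   Context: Conventions: $\mathbb{N}=\{0,1,2,\dots\}$. A Coxeter system $(W,S)$ consists of a group $W=\langle S\mid (st)^{m_{s,t}}=e,\ s,t\in S\rangle$ with $m_{s,s}=1$, $m_{s,t}\in\{2,3,\dots,\infty\}$ for $s\ne t$ (no relation is imposed if $m_{s,t}=\infty$). It has finite rank if $S$ is finite and is right-angled if $m_{s,t}\in\{2,\infty\}$ for all $s\neq t$. $|\cdot|$ denotes the word length on $W$ with respect to $S$. An induced square in $\Gamma$ consists of $s_1,s_2,s_3,s_4\in S$ with $m_{s_1,s_2}=m_{s_2,s_3}=m_{s_3,s_4}=m_{s_4,s_1}=2$ and $m_{s_1,s_3}=m_{s_2,s_4}=\infty$. $\mathrm{Cliq}(\Gamma)$ is the set of cliques (complete subgraphs) $\Gamma_0$ of $\Gamma$, including the empty clique (whose associated product equals $1$); $V\Gamma_0$ is the vertex set of $\Gamma_0$. $\mathbb{R}_{>0}^{(W,S)}$ is the set of tuples $q=(q_s)_{s\in S}$ of positive reals with $q_s=q_t$ whenever $s,t$ are conjugate in $W$. Put $p_s(q):=(q_s-1)/\sqrt{q_s}$. The Iwahori--Hecke algebra $\mathbb{C}_q[W]$ is the unital $*$-algebra with linear basis $(T^{(q)}_{\mathbf w})_{\mathbf w\in W}$, unit $T_e^{(q)}$, involution $(T^{(q)}_{\mathbf w})^*=T^{(q)}_{\mathbf w^{-1}}$, and multiplication determined by $T^{(q)}_sT^{(q)}_{\mathbf w}=T^{(q)}_{s\mathbf w}$ if $|s\mathbf w|>|\mathbf w|$ and $T^{(q)}_sT^{(q)}_{\mathbf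 w}=T^{(q)}_{s\mathbf w}+p_s(q)T^{(q)}_{\mathbf w}$ if $|s\mathbf w|<|\mathbf w|$ ($s\in S$, $\mathbf w\in W$). It is viewed as a $*$-subalgebra of $\mathcal{B}(\ell^2(W))$ via the faithful representation $T^{(q)}_s\delta_{\mathbf w}=\delta_{s\mathbf w}$ if $|s\mathbf w|>|\mathbf w|$, and $T^{(q)}_s\delta_{\mathbf w}=\delta_{s\mathbf w}+p_s(q)\delta_{\mathbf w}$ if $|s\mathbf w|<|\mathbf w|$, where $(\delta_{\mathbf w})_{\mathbf w\in W}$ is the canonical orthonormal basis; one has $T^{(q)}_{\mathbf w}\delta_e=\delta_{\mathbf w}$. For $n\in\mathbb{N}$, $\chi_n$ is the linear map on $\mathbb{C}_q[W]$ with $\chi_n(T^{(q)}_{\mathbf w})=T^{(q)}_{\mathbf w}$ if $|\mathbf w|=n$ and $0$ otherwise, so $\chi_n(\mathbb{C}_q[W])=\mathrm{Span}\{T^{(q)}_{\mathbf w}\mid |\mathbf w|=n\}$. $P_n\in\mathcal{B}(\ell^2(W))$ is the orthogonal projection onto $\mathrm{Span}\{\delta_{\mathbf w}\mid |\mathbf w|=n\}$. $\|\cdot\|$ is the operator norm and $\|\cdot\|_2$ the norm of $\ell^2(W)$. *)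

theory Defs
  imports "HOL-Analysis.Analysis" "HOL-Algebra.Algebra" "HOL-Library.Extended_Nat"
begin

text \<open>A word over \<open>S\<close> and its formal inverses is a list of letters; \<open>(s, True)\<close> stands for
  \<open>s\<close> and \<open>(s, False)\<close> for the inverse of \<open>s\<close>. Two words are related by \<open>pres_eq S R\<close> iff they
  represent the same element of the group with generators \<open>S\<close> and relators \<open>R\<close>.\<close>

abbreviation words :: "'a set \<Rightarrow> ('a \<times> bool) list set" where
  "words S \<equiv> lists (S \<times> UNIV)"

inductive pres_eq :: "'a set \<Rightarrow> ('a \<times> bool) list set \<Rightarrow> ('a \<times> bool) list \<Rightarrow> ('a \<times> bool) list \<Rightarrow> bool"
  for S :: "'a set" and R :: "('a \<times> bool) list set" where
  pres_refl: "u \<in> words S \<Longrightarrow> pres_eq S R u u"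
| pres_sym: "pres_eq S R u v \<Longrightarrow> pres_eq S R v u"
| pres_trans: "pres_eq S R u v \<Longrightarrow> pres_eq S R v w \<Longrightarrow> pres_eq S R u w"
| pres_cancel: "u \<in> words S \<Longrightarrow> v \<in> words S \<Longrightarrow> s \<in> S \<Longrightarrow>
    pres_eq S R (u @ [(s, b), (s, \<not> b)] @ v) (u @ v)"
| pres_relator: "u \<in> words S \<Longrightarrow> v \<in> words S \<Longrightarrow> r \<in> R \<Longrightarrow> pres_eq S R (u @ r @ v) (u @ v)"

definition eval_word :: "('a, 'b) monoid_scheme \<Rightarrow> ('a \<times> bool) list \<Rightarrow> 'a" where
  "eval_word G u = foldr (\<lambda>(s, b) g. (if b then s else inv\<^bsub>G\<^esub> s) \<otimes>\<^bsub>G\<^esub> g) u \<one>\<^bsub>G\<^esub>"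

definition presented_by :: "('a, 'b) monoid_scheme \<Rightarrow> 'a set \<Rightarrow> ('a \<times> bool) list set \<Rightarrow> bool" where
  "presented_by G S R \<longleftrightarrow> group G \<and> S \<subseteq> carrier G \<and> R \<subseteq> words S \<and> generate G S = carrier G \<and>
     (\<forall>u\<in>words S. \<forall>v\<in>words S. eval_word G u = eval_word G v \<longleftrightarrow> pres_eq S R u v)"

definition coxeter_relators :: "'a set \<Rightarrow> ('a \<Rightarrow> 'a \<Rightarrow> enat) \<Rightarrow> ('a \<times> bool) list set" where
  "coxeter_relators S m =
     {concat (replicate k [(s, True), (t, True)]) | s t k. s \<in> S \<and> t \<in> S \<and> m s t = enat k}"

definition coxeter_system :: "('a, 'b) monoid_scheme \<Rightarrow> 'a set \<Rightarrow> ('a \<Rightarrow> 'a \<Rightarrow> enat) \<Rightarrow> bool" where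
  "coxeter_system W S m \<longleftrightarrow>
     (\<forall>s\<in>S. m s s = 1) \<and>
     (\<forall>s\<in>S. \<forall>t\<in>S. s \<noteq> t \<longrightarrow> 2 \<le> m s t) \<and>
     (\<forall>s\<in>S. \<forall>t\<in>S. m s t = m t s) \<and>
     presented_by W S (coxeter_relators S m)"

definition right_angled :: "'a set \<Rightarrow> ('a \<Rightarrow> 'a \<Rightarrow> enat) \<Rightarrow> bool" where
  "right_angled S m \<longleftrightarrow> (\<forall>s\<in>S. \<forall>t\<in>S. s \<noteq> t \<longrightarrow> m s t \<in> {2, \<infinity>})"

definition word_prod :: "('a, 'b) monoid_scheme \<Rightarrow> 'a list \<Rightarrow> 'a" where
  "word_prod W l = foldr (\<lambda>s g. s \<otimes>\<^bsub>W\<^esub> g) l \<one>\<^bsub>W\<^esub>"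

text \<open>Positive words suffice for the word length, as the generators of a Coxeter system are
  involutions.\<close>

definition word_length :: "('a, 'b) monoid_scheme \<Rightarrow> 'a set \<Rightarrow> 'a \<Rightarrow> nat" where
  "word_length W S w = (LEAST n. \<exists>l\<in>lists S. length l = n \<and> word_prod W l = w)"

definition reduced_word :: "('a, 'b) monoid_scheme \<Rightarrow> 'a set \<Rightarrow> 'a \<Rightarrow> 'a list \<Rightarrow> bool" where
  "reduced_word W S w l \<longleftrightarrow> l \<in> lists S \<and> word_prod W l = w \<and> length l = word_length W S w"

definition graph_edges :: "'a set \<Rightarrow> ('a \<Rightarrow> 'a \<Rightarrow> enat) \<Rightarrow> ('a \<times> 'a) set" where
  "graph_edges S m = {(s, t) \<in> S \<times> S. m s t = 2}"

text \<open>A clique is identified with its vertex set.\<close>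

definition cliques :: "'a set \<Rightarrow> ('a \<times> 'a) set \<Rightarrow> 'a set set" where
  "cliques V E = {C. C \<subseteq> V \<and> (\<forall>s\<in>C. \<forall>t\<in>C. s \<noteq> t \<longrightarrow> (s, t) \<in> E)}"

definition has_induced_square :: "'a set \<Rightarrow> ('a \<Rightarrow> 'a \<Rightarrow> enat) \<Rightarrow> bool" where
  "has_induced_square S m \<longleftrightarrow>
     (\<exists>s1\<in>S. \<exists>s2\<in>S. \<exists>s3\<in>S. \<exists>s4\<in>S.
        m s1 s2 = 2 \<and> m s2 s3 = 2 \<and> m s3 s4 = 2 \<and> m s4 s1 = 2 \<and> m s1 s3 = \<infinity> \<and> m s2 s4 = \<infinity>)"

text \<open>Vectors are functions on the ambient type that vanish outside the carrier.\<close>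

definition ell2 :: "('a, 'b) monoid_scheme \<Rightarrow> ('a \<Rightarrow> complex) set" where
  "ell2 W = {f. (\<forall>w. w \<notin> carrier W \<longrightarrow> f w = 0) \<and> (\<lambda>w. (cmod (f w))\<^sup>2) summable_on carrier W}"

definition ell2_norm :: "('a, 'b) monoid_scheme \<Rightarrow> ('a \<Rightarrow> complex) \<Rightarrow> real" where
  "ell2_norm W f = sqrt (\<Sum>\<^sub>\<infinity>w\<in>carrier W. (cmod (f w))\<^sup>2)"

definition delta :: "'a \<Rightarrow> 'a \<Rightarrow> complex" where
  "delta w = (\<lambda>v. if v = w then 1 else 0)"

text \<open>The operator norm takes values in the extended reals; for a linear map of \<open>ell2 W\<close> to itself it is infinite iff the map is
  unbounded.\<close>

definition op_norm :: "('a, 'b) monoid_scheme \<Rightarrow> (('a \<Rightarrow> complex) \<Rightarrow> ('a \<Rightarrow> complex)) \<Rightarrow> ereal" where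
  "op_norm W A = (SUP \<xi>\<in>{\<xi> \<in> ell2 W. ell2_norm W \<xi> \<le> 1}. ereal (ell2_norm W (A \<xi>)))"

text \<open>The orthogonal projection onto the closed span of the \<open>delta w\<close> with \<open>w\<close> of length \<open>n\<close>; for
  finite \<open>S\<close> this span is finite-dimensional.\<close>

definition sphere_proj ::
  "('a, 'b) monoid_scheme \<Rightarrow> 'a set \<Rightarrow> nat \<Rightarrow> ('a \<Rightarrow> complex) \<Rightarrow> ('a \<Rightarrow> complex)" where
  "sphere_proj W S n \<xi> = (\<lambda>v. if v \<in> carrier W \<and> word_length W S v = n then \<xi> v else 0)"

definition hecke_params :: "('a, 'b) monoid_scheme \<Rightarrow> 'a set \<Rightarrow> ('a \<Rightarrow> real) set" where
  "hecke_params W S = {q. (\<forall>s\<in>S. 0 < q s) \<and>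
     (\<forall>s\<in>S. \<forall>t\<in>S. (\<exists>g\<in>carrier W. t = g \<otimes>\<^bsub>W\<^esub> s \<otimes>\<^bsub>W\<^esub> inv\<^bsub>W\<^esub> g) \<longrightarrow> q s = q t)}"

definition hecke_p :: "('a \<Rightarrow> real) \<Rightarrow> 'a \<Rightarrow> real" where
  "hecke_p q s = (q s - 1) / sqrt (q s)"

text \<open>The operator of a generator \<open>s\<close>, in coordinates. Its values on the \<open>delta w\<close> are given in
  \<open>hecke_gen_delta\<close> below.\<close>

definition hecke_gen ::
  "('a, 'b) monoid_scheme \<Rightarrow> 'a set \<Rightarrow> ('a \<Rightarrow> real) \<Rightarrow> 'a \<Rightarrow> ('a \<Rightarrow> complex) \<Rightarrow> ('a \<Rightarrow> complex)" where
  "hecke_gen W S q s \<xi> = (\<lambda>v. if v \<in> carrier W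
     then \<xi> (s \<otimes>\<^bsub>W\<^esub> v) +
       (if word_length W S (s \<otimes>\<^bsub>W\<^esub> v) < word_length W S v then of_real (hecke_p q s) * \<xi> v else 0)
     else 0)"

text \<open>The operator of a basis element \<open>w = s\<^sub>1 \<dots> s\<^sub>n\<close> (reduced) is the product of those of
  \<open>s\<^sub>1, \<dots>, s\<^sub>n\<close>, by the rule for multiplying by \<open>s\<close> in the length-increasing case. By Matsumoto's
  theorem and the braid relations, the choice of reduced word does not matter.\<close>

definition hecke_T ::
  "('a, 'b) monoid_scheme \<Rightarrow> 'a set \<Rightarrow> ('a \<Rightarrow> real) \<Rightarrow> 'a \<Rightarrow> ('a \<Rightarrow> complex) \<Rightarrow> ('a \<Rightarrow> complex)" where
  "hecke_T W S q w = foldr (\<lambda>s A. hecke_gen W S q s \<circ> A) (SOME l. reduced_word W S w l) id"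

text \<open>An element of the Iwahori--Hecke algebra is given by its finitely supported coefficients with
  respect to the basis of the \<open>T\<^sub>w\<close>; \<open>hecke_op\<close> is the operator on \<open>ell2 W\<close> that it represents.
  Only the latter depends on \<open>q\<close>.\<close>

definition hecke_algebra :: "('a, 'b) monoid_scheme \<Rightarrow> ('a \<Rightarrow> complex) set" where
  "hecke_algebra W = {x. finite {w. x w \<noteq> 0} \<and> {w. x w \<noteq> 0} \<subseteq> carrier W}"

definition hecke_op ::
  "('a, 'b) monoid_scheme \<Rightarrow> 'a set \<Rightarrow> ('a \<Rightarrow> real) \<Rightarrow> ('a \<Rightarrow> complex) \<Rightarrow> ('a \<Rightarrow> complex) \<Rightarrow> ('a \<Rightarrow> complex)" where
  "hecke_op W S q x \<xi> = (\<lambda>v. \<Sum>w\<in>{w. x w \<noteq> 0}. x w * hecke_T W S q w \<xi> v)"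

definition chi :: "('a, 'b) monoid_scheme \<Rightarrow> 'a set \<Rightarrow> nat \<Rightarrow> ('a \<Rightarrow> complex) \<Rightarrow> ('a \<Rightarrow> complex)" where
  "chi W S n x = (\<lambda>w. if word_length W S w = n then x w else 0)"

definition hecke_const :: "'a set \<Rightarrow> ('a \<Rightarrow> 'a \<Rightarrow> enat) \<Rightarrow> ('a \<Rightarrow> real) \<Rightarrow> real" where
  "hecke_const S m q = Max ((\<lambda>C. \<Prod>t\<in>C. \<bar>hecke_p q t\<bar>) ` cliques S (graph_edges S m))"

lemma coxeter_systemD:
  assumes "coxeter_system W S m"
  shows "group W" "S \<subseteq> carrier W" "generate W S = carrier W"
    "s \<in> S \<Longrightarrow> s \<otimes>\<^bsub>W\<^esub> s = \<one>\<^bsub>W\<^esub>"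
proof -
  have P: "presented_by W S (coxeter_relators S m)" and m1: "\<And>s. s \<in> S \<Longrightarrow> m s s = 1"
    using assms by (auto simp: coxeter_system_def)
  show "group W" "S \<subseteq> carrier W" "generate W S = carrier W"
    using P by (auto simp: presented_by_def)
  interpret group W by fact
  show "s \<otimes>\<^bsub>W\<^esub> s = \<one>\<^bsub>W\<^esub>" if s: "s \<in> S"
  proof -
    have "[(s, True), (s, True)] \<in> coxeter_relators S m"
      unfolding coxeter_relators_def using s m1[OF s]
      by (auto intro!: exI[of _ s] exI[of _ 1] simp: one_enat_def)
    then have "pres_eq S (coxeter_relators S m) ([] @ [(s, True), (s, True)] @ []) ([] @ [])"
      by (intro pres_relator) auto
    then have "eval_word W [(s, True), (s, True)] = eval_word W []"
      using P s by (auto simp: presented_by_def)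
    then show ?thesis
      using s \<open>S \<subseteq> carrier W\<close> by (auto simp: eval_word_def)
  qed
qed

lemma hecke_gen_delta:
  assumes "coxeter_system W S m" "s \<in> S" "w \<in> carrier W"
  shows "word_length W S w \<le> word_length W S (s \<otimes>\<^bsub>W\<^esub> w) \<Longrightarrow>
      hecke_gen W S q s (delta w) = delta (s \<otimes>\<^bsub>W\<^esub> w)"
    and "word_length W S (s \<otimes>\<^bsub>W\<^esub> w) < word_length W S w \<Longrightarrow>
      hecke_gen W S q s (delta w) =
        (\<lambda>v. delta (s \<otimes>\<^bsub>W\<^esub> w) v + of_real (hecke_p q s) * delta w v)"
proof -
  interpret group W using coxeter_systemD[OF assms(1)] by blast
  have s: "s \<in> carrier W" "s \<otimes>\<^bsub>W\<^esub> s = \<one>\<^bsub>W\<^esub>"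
    using coxeter_systemD[OF assms(1)] assms(2) by auto
  have iff: "s \<otimes>\<^bsub>W\<^esub> v = w \<longleftrightarrow> v = s \<otimes>\<^bsub>W\<^esub> w" if "v \<in> carrier W" for v
    using s assms(3) that by (metis l_one m_assoc)
  have sw: "s \<otimes>\<^bsub>W\<^esub> w \<in> carrier W" using s assms by auto
  show "hecke_gen W S q s (delta w) = delta (s \<otimes>\<^bsub>W\<^esub> w)"
    if "word_length W S w \<le> word_length W S (s \<otimes>\<^bsub>W\<^esub> w)"
    using that iff sw assms(3) by (auto simp: hecke_gen_def delta_def fun_eq_iff)
  show "hecke_gen W S q s (delta w) =
      (\<lambda>v. delta (s \<otimes>\<^bsub>W\<^esub> w) v + of_real (hecke_p q s) * delta w v)"
    if "word_length W S (s \<otimes>\<^bsub>W\<^esub> w) < word_length W S w"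
    using that iff sw assms(3) by (auto simp: hecke_gen_def delta_def fun_eq_iff)
qed

lemma word_prod_surj:
  assumes "coxeter_system W S m" "w \<in> carrier W"
  shows "\<exists>l\<in>lists S. word_prod W l = w"
proof -
  interpret group W using coxeter_systemD[OF assms(1)] by blast
  note D = coxeter_systemD[OF assms(1)]
  have closed: "word_prod W l \<in> carrier W" if "l \<in> lists S" for l
    using that D(2) by (induction l) (auto simp: word_prod_def)
  have append: "word_prod W (l @ l') = word_prod W l \<otimes>\<^bsub>W\<^esub> word_prod W l'"
    if "l \<in> lists S" "l' \<in> lists S" for l l'
    using that(1)
  proof (induction l)
    case Nil
    then show ?case using closed[OF that(2)] by (simp add: word_prod_def)
  next
    case (Cons a l)
    then show ?case using closed[OF that(2)] closed[of l] D(2)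
      by (auto simp: word_prod_def m_assoc)
  qed
  have "w \<in> generate W S" using D(3) assms(2) by simp
  then show ?thesis
  proof induction
    case one
    show ?case by (rule bexI[of _ "[]"]) (auto simp: word_prod_def)
  next
    case (incl h)
    then show ?case using D(2) by (intro bexI[of _ "[h]"]) (auto simp: word_prod_def)
  next
    case (inv h)
    then have "inv\<^bsub>W\<^esub> h = h" using D by (metis inv_equality subsetD)
    then show ?case using D(2) inv by (intro bexI[of _ "[h]"]) (auto simp: word_prod_def)
  next
    case (eng h1 h2)
    then show ?case by (metis append append_in_lists_conv)
  qed
qed

lemma hecke_T_delta_one:
  assumes "coxeter_system W S m" "w \<in> carrier W"
  shows "hecke_T W S q w (delta \<one>\<^bsub>W\<^esub>) = delta w"
proof -
  interpret group W using coxeter_systemD[OF assms(1)] by blast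
  note D = coxeter_systemD[OF assms(1)]
  have closed: "word_prod W l \<in> carrier W" if "l \<in> lists S" for l
    using that D(2) by (induction l) (auto simp: word_prod_def)
  have len_le: "word_length W S (word_prod W l) \<le> length l" if "l \<in> lists S" for l
    unfolding word_length_def using that by (intro Least_le) auto
  have len_ex: "\<exists>l. reduced_word W S v l" if "v \<in> carrier W" for v
  proof -
    from word_prod_surj[OF assms(1) that] obtain l where "l \<in> lists S" "word_prod W l = v" by auto
    then have "\<exists>n. \<exists>l\<in>lists S. length l = n \<and> word_prod W l = v" by auto
    from LeastI_ex[OF this] show ?thesis
      unfolding reduced_word_def word_length_def by auto
  qed
  have main: "foldr (\<lambda>s A. hecke_gen W S q s \<circ> A) l id (delta \<one>\<^bsub>W\<^esub>) = delta (word_prod W l)"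
    if "l \<in> lists S" "length l = word_length W S (word_prod W l)" for l
    using that
  proof (induction l rule: list.induct)
    case Nil
    then show ?case by (simp add: word_prod_def)
  next
    case (Cons s l)
    have sl: "s \<in> S" "l \<in> lists S" using Cons.prems(1) by auto
    have prod: "word_prod W (s # l) = s \<otimes>\<^bsub>W\<^esub> word_prod W l" by (simp add: word_prod_def)
    obtain l' where l': "reduced_word W S (word_prod W l) l'" using len_ex closed sl by blast
    then have "word_prod W (s # l') = word_prod W (s # l)" "s # l' \<in> lists S"
      using sl by (auto simp: reduced_word_def word_prod_def)
    with len_le[of "s # l'"] Cons.prems(2) l'
    have "length l \<le> word_length W S (word_prod W l)"
      by (simp add: reduced_word_def)
    with len_le[OF sl(2)] have eq: "length l = word_length W S (word_prod W l)" by simp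
    have "word_length W S (word_prod W l) \<le> word_length W S (s \<otimes>\<^bsub>W\<^esub> word_prod W l)"
      using eq Cons.prems(2) prod by simp
    with hecke_gen_delta(1)[OF assms(1) sl(1) closed[OF sl(2)]] Cons.IH[OF sl(2) eq] prod
    show ?case by simp
  qed
  from someI_ex[OF len_ex[OF assms(2)]]
  have red: "reduced_word W S w (SOME l. reduced_word W S w l)" .
  define l where "l = (SOME l. reduced_word W S w l)"
  have "l \<in> lists S" "word_prod W l = w" "length l = word_length W S w"
    using red[folded l_def] by (auto simp: reduced_word_def)
  with main[of l] show ?thesis
    by (simp add: hecke_T_def l_def[symmetric])
qed

end

theory Submission
  imports Defs
begin

text \<open>
  Write \<open>T\<^sub>w \<delta>\<^sub>v\<close> for the action of a basis element of length \<open>n\<close> on a basis vector of length \<open>j\<close>.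
  Multiplying out a reduced word of \<open>w\<close> letter by letter, each letter either lengthens the vector,
  or cancels against it, or is kept with a factor \<open>p\<^sub>s\<close>. In a right-angled group a letter
  that cancels or is kept commutes with everything in the vector that precedes the letter it meets. Hence every contribution to the
  coefficient of \<open>T\<^sub>w \<delta>\<^sub>v\<close> at \<open>u\<close> comes from a splitting
  \<open>w = g k a\<close>, \<open>v = a\<^sup>-\<^sup>1 k b\<close>, \<open>u = g k b\<close> along which lengths add up, where \<open>k\<close> is the product of
  a clique of kept letters, and it has absolute value at most the product of the \<open>\<bar>p\<^sub>t\<bar>\<close> over that clique
  (\<open>hecke_word_bound\<close>). Such a splitting is a tripod with legs \<open>g\<close>, \<open>a\<close>, \<open>b\<close> and centre \<open>k\<close>, and for a
  given clique the lengths of its legs are determined by \<open>i\<close>, \<open>j\<close> and \<open>n\<close>.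

  For a fixed clique, Cauchy--Schwarz in the variable \<open>a\<close> bounds the operator by the product of the
  Hilbert--Schmidt norms of \<open>(g, a) \<mapsto> x (g k a)\<close> and \<open>(a, b) \<mapsto> \<xi> (a\<^sup>-\<^sup>1 k b)\<close>
  (\<open>tripod_bound\<close>). What is lost in passing from \<open>(g, a)\<close>, \<open>(a, b)\<close> and \<open>(g, b)\<close> back to the group elements
  that they represent is the number of prefixes of a given length of one element.

  So statement (1) amounts to a uniform bound for that number (\<open>card_prefixes\<close>). Two prefixes \<open>g\<close>, \<open>h\<close>
  of the same length can be written \<open>g = c x\<close>, \<open>h = c y\<close> where every letter of \<open>x\<close> commutes with and
  differs from every letter of \<open>y\<close>. If both \<open>x\<close> and \<open>y\<close> involved a pair of letters that do not commute,
  these four letters would form an induced square. Otherwise the letters of \<open>x\<close>, say, form a clique,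
  so that \<open>x\<close> has length at most \<open>card S\<close>, and so has \<open>y\<close> (\<open>prefixes_close\<close>). Thus \<open>h\<close> is
  within distance \<open>2 * card S\<close> of \<open>g\<close>.

  For statement (2), an induced square generates a product of two infinite dihedral groups, which
  contains the elements \<open>A\<^sup>k B\<^sup>l\<close> with \<open>A = s\<^sub>1 s\<^sub>3\<close> and \<open>B = s\<^sub>2 s\<^sub>4\<close> of length \<open>2 k + 2 l\<close>. The
  vector that is constant on the \<open>r + 1\<close> elements with \<open>k + l = r\<close> is convolved with itself without
  any cancellation, so that no parameter enters, and the result is supported on only \<open>2 r + 1\<close> elements. By Cauchy--Schwarz the
  ratio of the norms is at least of order \<open>\<surd>r\<close> (\<open>square_lower_bound\<close>).

  The combinatorics of the group is derived from two kinds of actions for which the defining relations are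
  easily checked: one on parities of inversions, which yields the exchange condition, and, for every pair of
  letters that do not commute, one on the integer line.
\<close>

section \<open>Words and lengths in a right-angled Coxeter group\<close>

locale racg = group W for W :: "('a, 'b) monoid_scheme" (structure) +
  fixes S :: "'a set" and m :: "'a \<Rightarrow> 'a \<Rightarrow> enat"
  assumes cox: "coxeter_system W S m" and ra: "right_angled S m"
begin

abbreviation wp :: "'a list \<Rightarrow> 'a" where "wp \<equiv> word_prod W"
abbreviation len :: "'a \<Rightarrow> nat" where "len \<equiv> word_length W S"

definition is_reduced :: "'a list \<Rightarrow> bool" where
  "is_reduced l \<longleftrightarrow> set l \<subseteq> S \<and> len (wp l) = length l"

lemma gen_in: "s \<in> S \<Longrightarrow> s \<in> carrier W"
  using coxeter_systemD(2)[OF cox] by auto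

lemma gen_sq: "s \<in> S \<Longrightarrow> s \<otimes> s = \<one>"
  using coxeter_systemD(4)[OF cox] by auto

lemma gen_inv: "s \<in> S \<Longrightarrow> inv s = s"
  using gen_sq gen_in by (metis inv_equality)

lemma gen_cancel: "s \<in> S \<Longrightarrow> w \<in> carrier W \<Longrightarrow> s \<otimes> (s \<otimes> w) = w"
  using gen_sq gen_in by (metis l_one m_assoc)

lemma m_same: "s \<in> S \<Longrightarrow> m s s = 1"
  using cox by (auto simp: coxeter_system_def)

lemma m_sym: "s \<in> S \<Longrightarrow> t \<in> S \<Longrightarrow> m s t = m t s"
  using cox by (auto simp: coxeter_system_def)

lemma m_cases:
  assumes "s \<in> S" "t \<in> S"
  obtains "s = t" "m s t = 1" | "s \<noteq> t" "m s t = 2" | "s \<noteq> t" "m s t = \<infinity>"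
proof (cases "s = t")
  case True
  then show ?thesis using that(1) m_same assms by simp
next
  case False
  then have "m s t \<in> {2, \<infinity>}" using ra assms unfolding right_angled_def by simp
  then show ?thesis using that(2,3) False by auto
qed

lemma m_two_neq: "s \<in> S \<Longrightarrow> m s t = 2 \<Longrightarrow> s \<noteq> t"
  using m_same[of s] by (auto simp: one_enat_def numeral_eq_enat)

lemma wp_Nil [simp]: "wp [] = \<one>"
  by (simp add: word_prod_def)

lemma wp_Cons [simp]: "wp (s # l) = s \<otimes> wp l"
  by (simp add: word_prod_def)

lemma wp_closed [simp]: "set l \<subseteq> S \<Longrightarrow> wp l \<in> carrier W"
  by (induction l) (auto simp: gen_in)

lemma wp_append: "set l \<subseteq> S \<Longrightarrow> set l' \<subseteq> S \<Longrightarrow> wp (l @ l') = wp l \<otimes> wp l'"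
  by (induction l) (auto simp: gen_in m_assoc)

lemma wp_rev: "set l \<subseteq> S \<Longrightarrow> wp (rev l) = inv (wp l)"
  by (induction l) (auto simp: gen_in wp_append gen_inv inv_mult_group)

lemma eval_word_eq_wp: "u \<in> words S \<Longrightarrow> eval_word W u = wp (map fst u)"
  by (induction u) (auto simp: eval_word_def gen_inv)

lemma pres_eq_iff: "u \<in> words S \<Longrightarrow> v \<in> words S \<Longrightarrow>
   pres_eq S (coxeter_relators S m) u v \<longleftrightarrow> wp (map fst u) = wp (map fst v)"
  using cox by (auto simp: coxeter_system_def presented_by_def eval_word_eq_wp)

lemma gen_commute:
  assumes "s \<in> S" "t \<in> S" "m s t = 2"
  shows "s \<otimes> t = t \<otimes> s"
proof -
  let ?r = "concat (replicate 2 [(s, True), (t, True)])"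
  have "?r \<in> coxeter_relators S m"
    unfolding coxeter_relators_def using assms by (fastforce simp: numeral_eq_enat)
  then have "pres_eq S (coxeter_relators S m) ([] @ ?r @ []) ([] @ [])"
    by (intro pres_relator) auto
  then have "wp (map fst ?r) = wp []"
    using assms by (subst (asm) pres_eq_iff) (auto simp: numeral_2_eq_2)
  then have "s \<otimes> (t \<otimes> (s \<otimes> t)) = \<one>"
    using assms by (simp add: numeral_2_eq_2 gen_in)
  then have "s \<otimes> (s \<otimes> (t \<otimes> (s \<otimes> t))) = s" using assms by (simp add: gen_in)
  then have "t \<otimes> (s \<otimes> t) = s" using assms by (simp add: gen_in gen_cancel)
  then have "t \<otimes> (t \<otimes> (s \<otimes> t)) = t \<otimes> s" by simp
  then show ?thesis using assms by (simp add: gen_in gen_cancel)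
qed

text \<open>The working form of the presentation: a family of maps indexed by \<open>S\<close> that satisfies the
  right-angled Coxeter relations on a set \<open>D\<close> is an action of \<open>W\<close> on \<open>D\<close>, so the effect of a word depends only on
  its product.\<close>

lemma word_action:
  assumes closed: "\<And>s x. s \<in> S \<Longrightarrow> x \<in> D \<Longrightarrow> f s x \<in> D"
    and invol: "\<And>s x. s \<in> S \<Longrightarrow> x \<in> D \<Longrightarrow> f s (f s x) = x"
    and comm: "\<And>s t x. s \<in> S \<Longrightarrow> t \<in> S \<Longrightarrow> s \<noteq> t \<Longrightarrow> m s t = 2 \<Longrightarrow> x \<in> D \<Longrightarrow>
      f s (f t (f s (f t x))) = x"
    and l: "set l \<subseteq> S" "set l' \<subseteq> S" "wp l = wp l'" and x: "x \<in> D"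
  shows "foldr f l x = foldr f l' x"
proof -
  let ?F = "\<lambda>u. foldr f (map fst u)"
  have cl: "foldr f l x \<in> D" if "set l \<subseteq> S" "x \<in> D" for l x
    using that by (induction l) (auto simp: closed)
  have inw: "set (map fst u) \<subseteq> S" if "u \<in> words S" for u :: "('a \<times> bool) list"
    using that by (fastforce simp: lists_eq_set)
  have rel: "?F r y = y" if r0: "r \<in> coxeter_relators S m" and y: "y \<in> D" for r y
  proof -
    obtain s t k where r: "r = concat (replicate k [(s, True), (t, True)])" "s \<in> S" "t \<in> S" "m s t = enat k"
      using r0 unfolding coxeter_relators_def by blast
    show ?thesis
    proof (rule m_cases[OF r(2,3)])
      assume "s = t" "m s t = 1"
      then have "k = 1" using r(4) by (simp add: one_enat_def)
      then show ?thesis using r \<open>s = t\<close> invol y by simp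
    next
      assume "s \<noteq> t" "m s t = 2"
      then have "k = 2" using r(4) by (simp add: numeral_eq_enat)
      then show ?thesis using r \<open>s \<noteq> t\<close> \<open>m s t = 2\<close> comm[OF r(2,3)] y by (simp add: numeral_2_eq_2)
    next
      assume "m s t = \<infinity>"
      then show ?thesis using r(4) by simp
    qed
  qed
  have main: "\<forall>x\<in>D. ?F u x = ?F v x" if "pres_eq S (coxeter_relators S m) u v" for u v
    using that
  proof induction
    case (pres_cancel u v s b)
    then show ?case using invol cl[OF inw] by simp
  next
    case (pres_relator u v r)
    then show ?case using rel cl[OF inw] by simp
  qed simp_all
  let ?u = "map (\<lambda>s. (s, True)) l" and ?v = "map (\<lambda>s. (s, True)) l'"
  have "pres_eq S (coxeter_relators S m) ?u ?v"
    using l by (subst pres_eq_iff) (auto simp: comp_def)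
  from main[OF this] x show ?thesis by (auto simp: comp_def)
qed

lemma len_le: "set l \<subseteq> S \<Longrightarrow> len (wp l) \<le> length l"
  unfolding word_length_def lists_eq_set by (intro Least_le) auto

lemma reduced_word_ex:
  assumes "w \<in> carrier W" obtains l where "is_reduced l" "wp l = w"
proof -
  from word_prod_surj[OF cox assms] have "\<exists>n. \<exists>l\<in>lists S. length l = n \<and> wp l = w" by auto
  from LeastI_ex[OF this] obtain l where "set l \<subseteq> S" "wp l = w" "length l = len w"
    unfolding word_length_def by auto
  then show ?thesis using that[of l] by (simp add: is_reduced_def)
qed

lemma len_one [simp]: "len \<one> = 0"
  using len_le[of "[]"] by simp

lemma len_mult:
  assumes "v \<in> carrier W" "w \<in> carrier W"
  shows "len (v \<otimes> w) \<le> len v + len w"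
proof -
  obtain k l where "is_reduced k" "wp k = v" "is_reduced l" "wp l = w" using assms reduced_word_ex by metis
  then show ?thesis using len_le[of "k @ l"] by (simp add: is_reduced_def wp_append)
qed

lemma len_gen: "s \<in> S \<Longrightarrow> len s \<le> 1"
  using len_le[of "[s]"] by (simp add: gen_in)

lemma len_gen_mult: "s \<in> S \<Longrightarrow> w \<in> carrier W \<Longrightarrow> len (s \<otimes> w) \<le> len w + 1"
  using len_mult[of s w] len_gen[of s] gen_in[of s] by simp

lemma len_inv:
  assumes "w \<in> carrier W" shows "len (inv w) = len w"
proof -
  have "len (inv w) \<le> len w" if w: "w \<in> carrier W" for w
  proof -
    obtain l where l: "is_reduced l" "wp l = w" using reduced_word_ex[OF w] .
    then have "len (wp (rev l)) \<le> length l" using len_le[of "rev l"] by (auto simp: is_reduced_def)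
    then show ?thesis using l wp_rev[of l] by (auto simp: is_reduced_def)
  qed
  from this[OF assms] this[of "inv w"] show ?thesis using assms by simp
qed

section \<open>Infinite dihedral quotients\<close>

text \<open>The reflections \<open>a\<close> and \<open>b\<close> of the integer line swap the ends of the edges \<open>{2k, 2k + 1}\<close> and
  \<open>{2k - 1, 2k}\<close>, respectively; all other letters act trivially. For letters without a relation this
  is the quotient of \<open>W\<close> onto an infinite dihedral group, in a form in which every letter moves
  every point by at most one. Displacements are therefore lower bounds for lengths.\<close>

definition line :: "'a \<Rightarrow> 'a \<Rightarrow> 'a \<Rightarrow> int \<Rightarrow> int" where
  "line a b s x = (if s = a then (if even x then x + 1 else x - 1)
     else if s = b then (if even x then x - 1 else x + 1) else x)"

lemma line_invol: "line a b s (line a b s x) = x"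
  by (cases "s = a"; cases "s = b"; cases "even x") (simp_all add: line_def)

lemma line_other: "s \<noteq> a \<Longrightarrow> s \<noteq> b \<Longrightarrow> line a b s x = x"
  by (simp add: line_def)

lemma line_action:
  assumes "a \<in> S" "b \<in> S" "m a b = \<infinity>" "set l \<subseteq> S" "set l' \<subseteq> S" "wp l = wp l'"
  shows "foldr (line a b) l x = foldr (line a b) l' x"
proof (rule word_action[where D = UNIV])
  fix s t x assume st: "s \<in> S" "t \<in> S" "s \<noteq> t" "m s t = 2"
  have "\<not> (s = a \<and> t = b)" "\<not> (s = b \<and> t = a)" using st assms(1-3) m_sym[of a b] by auto
  then consider "s \<noteq> a" "s \<noteq> b" | "t \<noteq> a" "t \<noteq> b" using st(3) by blast
  then show "line a b s (line a b t (line a b s (line a b t x))) = x"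
    by cases (simp_all add: line_other line_invol)
qed (use assms(4-6) in \<open>simp_all add: line_invol\<close>)

lemma line_displacement:
  "\<bar>foldr (line a b) l x - x\<bar> \<le> int (length (filter (\<lambda>s. s \<in> {a, b}) l))"
proof (induction l)
  case (Cons s l)
  have "\<bar>line a b s y - y\<bar> \<le> (if s \<in> {a, b} then 1 else 0)" for y
    by (simp add: line_def)
  from this[of "foldr (line a b) l x"] Cons show ?case
    by (cases "s \<in> {a, b}") (simp_all, linarith?)
qed simp

fun alternating :: "'a \<Rightarrow> 'a \<Rightarrow> nat \<Rightarrow> 'a list" where
  "alternating a b 0 = []"
| "alternating a b (Suc k) = a # alternating b a k"

lemma alternating_in: "a \<in> S \<Longrightarrow> b \<in> S \<Longrightarrow> set (alternating a b k) \<subseteq> S"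
  by (induction k arbitrary: a b) auto

lemma length_alternating [simp]: "length (alternating a b k) = k"
  by (induction k arbitrary: a b) auto

text \<open>The parity of the end point is part of the induction: it decides in which direction the next letter moves.\<close>

lemma line_alternating_displacement:
  assumes "a \<noteq> b"
  shows "(\<exists>x. foldr (line a b) (alternating a b k) x = x + int k \<and> odd (foldr (line a b) (alternating a b k) x)) \<and>
     (\<exists>x. foldr (line a b) (alternating b a k) x = x + int k \<and> even (foldr (line a b) (alternating b a k) x))"
proof (induction k)
  case 0
  show ?case by (auto intro: exI[of _ 1])
next
  case (Suc k)
  obtain x y where
    x: "foldr (line a b) (alternating a b k) x = x + int k" "odd (x + int k)" and
    y: "foldr (line a b) (alternating b a k) y = y + int k" "even (y + int k)"
    using Suc.IH by auto
  have "foldr (line a b) (alternating a b (Suc k)) y = y + int (Suc k)" "odd (y + int (Suc k))"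
    using y by (simp_all add: line_def)
  moreover have "foldr (line a b) (alternating b a (Suc k)) x = x + int (Suc k)" "even (x + int (Suc k))"
    using x assms by (simp_all add: line_def)
  ultimately show ?case by metis
qed

lemma alternating_shortest:
  assumes "a \<in> S" "b \<in> S" "m a b = \<infinity>" "set l \<subseteq> S" "wp l = wp (alternating a b k)"
  shows "k \<le> length l"
proof -
  have ab: "a \<noteq> b" using m_same[of a] assms(1,3) by auto
  obtain x where x: "foldr (line a b) (alternating a b k) x = x + int k"
    using line_alternating_displacement[OF ab, of k] by blast
  have "foldr (line a b) l x = x + int k"
    using line_action[OF assms(1-4) alternating_in[OF assms(1,2)] assms(5)] x by simp
  then have "int k \<le> int (length (filter (\<lambda>s. s \<in> {a, b}) l))"
    using line_displacement[of a b l x] by simp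
  also have "\<dots> \<le> int (length l)" by simp
  finally show ?thesis by simp
qed

section \<open>Inversions and the exchange condition\<close>

text \<open>A word acts on sets of group elements, given by their characteristic functions, so that the empty set is
  sent to the set of those reflections whose wall is crossed an odd number of times when the word is read
  from the left. A letter \<open>s\<close> conjugates by \<open>s\<close> and toggles \<open>s\<close> itself. Outside the carrier the value is
  normalised to \<open>False\<close>, which makes the relations hold as equations of functions.\<close>

definition flip :: "'a \<Rightarrow> ('a \<Rightarrow> bool) \<Rightarrow> ('a \<Rightarrow> bool)" where
  "flip s f r = (r \<in> carrier W \<and> ((r = s) \<noteq> f (s \<otimes> r \<otimes> s)))"

definition inversions :: "'a list \<Rightarrow> 'a \<Rightarrow> bool" where
  "inversions l = foldr flip l (\<lambda>_. False)"

lemma inversions_Cons: "r \<in> carrier W \<Longrightarrow> inversions (s # l) r = ((r = s) \<noteq> inversions l (s \<otimes> r \<otimes> s))"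
  by (simp add: inversions_def flip_def)

lemma conj_conj: "s \<in> S \<Longrightarrow> x \<in> carrier W \<Longrightarrow> s \<otimes> (s \<otimes> x \<otimes> s) \<otimes> s = x"
  by (simp add: m_assoc gen_in gen_cancel gen_sq)

lemma conj_eq_iff:
  assumes "s \<in> S" "r \<in> carrier W" "t \<in> carrier W"
  shows "s \<otimes> r \<otimes> s = t \<longleftrightarrow> r = s \<otimes> t \<otimes> s"
  using conj_conj[of s r] conj_conj[of s t] assms by metis

text \<open>For commuting letters \<open>s \<noteq> t\<close> the word \<open>stst\<close> toggles \<open>s\<close> twice and \<open>t\<close> twice.\<close>

lemma inversions_cong:
  assumes "set l \<subseteq> S" "set l' \<subseteq> S" "wp l = wp l'"
  shows "inversions l = inversions l'"
  unfolding inversions_def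
proof (rule word_action[where D = "{f. \<forall>r. r \<notin> carrier W \<longrightarrow> \<not> f r}"])
  fix s f assume s: "s \<in> S" and f: "f \<in> {f. \<forall>r. r \<notin> carrier W \<longrightarrow> \<not> f r}"
  show "flip s (flip s f) = f"
  proof
    fix r
    show "flip s (flip s f) r = f r"
    proof (cases "r \<in> carrier W")
      case True
      then have "s \<otimes> r \<otimes> s = s \<longleftrightarrow> r = s"
        using conj_eq_iff[OF s, of r s] s by (simp add: gen_in gen_sq)
      then show ?thesis using True s
        by (auto simp: flip_def gen_in conj_conj simp del: r_cancel_one r_cancel_one' l_cancel_one l_cancel_one')
    qed (use f in \<open>simp add: flip_def\<close>)
  qed
next
  fix s t f assume s: "s \<in> S" and t: "t \<in> S" and st: "s \<noteq> t" "m s t = 2"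
    and f: "f \<in> {f. \<forall>r. r \<notin> carrier W \<longrightarrow> \<not> f r}"
  have c: "s \<otimes> t = t \<otimes> s" using gen_commute[OF s t] st by simp
  have conj_s: "s \<otimes> x \<otimes> s = s \<longleftrightarrow> x = s" if "x \<in> carrier W" for x
    using conj_eq_iff[OF s that gen_in[OF s]] by (simp only: gen_sq[OF s] l_one[OF gen_in[OF s]])
  have conj_t: "t \<otimes> x \<otimes> t = t \<longleftrightarrow> x = t" if "x \<in> carrier W" for x
    using conj_eq_iff[OF t that gen_in[OF t]] by (simp only: gen_sq[OF t] l_one[OF gen_in[OF t]])
  show "flip s (flip t (flip s (flip t f))) = f"
  proof
    fix r
    show "flip s (flip t (flip s (flip t f))) r = f r"
    proof (cases "r \<in> carrier W")
      case True
      have sts: "s \<otimes> t \<otimes> s = t" "t \<otimes> s \<otimes> t = s"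
        using s t c by (metis gen_in gen_cancel m_assoc)+
      have a: "s \<otimes> x \<otimes> s = t \<longleftrightarrow> x = t" if "x \<in> carrier W" for x
        using conj_eq_iff[OF s that gen_in[OF t]] unfolding sts .
      have b: "t \<otimes> x \<otimes> t = s \<longleftrightarrow> x = s" if "x \<in> carrier W" for x
        using conj_eq_iff[OF t that gen_in[OF s]] unfolding sts .
      have cl: "s \<otimes> r \<otimes> s \<in> carrier W" "t \<otimes> (s \<otimes> r \<otimes> s) \<otimes> t \<in> carrier W"
        using True s t by (simp_all add: gen_in)
      have e: "s \<otimes> r \<otimes> s = t \<longleftrightarrow> r = t" "t \<otimes> (s \<otimes> r \<otimes> s) \<otimes> t = s \<longleftrightarrow> r = s"
         "s \<otimes> (t \<otimes> (s \<otimes> r \<otimes> s) \<otimes> t) \<otimes> s = t \<longleftrightarrow> r = t"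
        using a[OF True] b[OF cl(1)] a[OF cl(2)] conj_s[OF True]
          conj_t[OF cl(1)] by blast+
      have "t \<otimes> (s \<otimes> (t \<otimes> (s \<otimes> r \<otimes> s) \<otimes> t) \<otimes> s) \<otimes> t = (t \<otimes> s \<otimes> t) \<otimes> s \<otimes> r \<otimes> (s \<otimes> (t \<otimes> s \<otimes> t))"
        using True s t by (simp add: m_assoc gen_in)
      also have "\<dots> = s \<otimes> s \<otimes> r \<otimes> (s \<otimes> s)" unfolding sts ..
      also have "\<dots> = r" using True s t by (simp add: gen_sq)
      finally have r: "t \<otimes> (s \<otimes> (t \<otimes> (s \<otimes> r \<otimes> s) \<otimes> t) \<otimes> s) \<otimes> t = r" .
      have "flip s (flip t (flip s (flip t f))) r =
        ((r = s) \<noteq> ((r = t) \<noteq> ((r = s) \<noteq> ((r = t) \<noteq> f r))))"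
        using True s t by (simp add: flip_def gen_in e r del: r_cancel_one r_cancel_one' l_cancel_one l_cancel_one')
      then show ?thesis by blast
    qed (use f in \<open>simp add: flip_def\<close>)
  qed
qed (use assms in \<open>auto simp: flip_def\<close>)

text \<open>A reflection \<open>r\<close> that occurs among the crossed walls is a conjugate of some letter by
  the part of the word before it, and multiplying by \<open>r\<close> deletes this letter.\<close>

lemma inversions_delete:
  assumes "set l \<subseteq> S" "r \<in> carrier W" "inversions l r"
  shows "\<exists>l1 t l2. l = l1 @ t # l2 \<and> r \<otimes> wp l = wp (l1 @ l2)"
  using assms
proof (induction l arbitrary: r)
  case Nil
  then show ?case by (simp add: inversions_def)
next
  case (Cons t l)
  note [simp] = gen_in[of t]
  show ?case
  proof (cases "r = t")
    case True
    then have "t # l = [] @ t # l \<and> r \<otimes> wp (t # l) = wp ([] @ l)"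
      using Cons.prems by (simp add: gen_cancel)
    then show ?thesis by blast
  next
    case False
    then have "inversions l (t \<otimes> r \<otimes> t)" using Cons.prems by (simp add: inversions_Cons)
    from Cons.IH[OF _ _ this] Cons.prems obtain l1 u l2 where
      l: "l = l1 @ u # l2" "t \<otimes> r \<otimes> t \<otimes> wp l = wp (l1 @ l2)" by auto
    have "wp ((t # l1) @ l2) = t \<otimes> (t \<otimes> r \<otimes> t \<otimes> wp l)" using l(2) by simp
    also have "\<dots> = r \<otimes> wp (t # l)" using Cons.prems by (simp add: m_assoc gen_cancel)
    finally have "t # l = (t # l1) @ u # l2 \<and> r \<otimes> wp (t # l) = wp ((t # l1) @ l2)" using l(1) by simp
    then show ?thesis by blast
  qed
qed

definition descent :: "'a \<Rightarrow> 'a \<Rightarrow> bool" where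
  "descent s w \<longleftrightarrow> len (s \<otimes> w) < len w"

lemma inversions_descent:
  assumes "s \<in> S" "set l \<subseteq> S" "inversions l s"
  shows "descent s (wp l)"
proof -
  obtain k where k: "is_reduced k" "wp k = wp l" using reduced_word_ex assms(2) wp_closed by blast
  then have "inversions k s" using assms inversions_cong[of k l] by (simp add: is_reduced_def)
  from inversions_delete[OF _ _ this] k assms obtain l1 t l2 where
    "k = l1 @ t # l2" "s \<otimes> wp k = wp (l1 @ l2)" by (auto simp: is_reduced_def gen_in)
  then show ?thesis using k len_le[of "l1 @ l2"] by (simp add: is_reduced_def descent_def)
qed

text \<open>Passing from \<open>w\<close> to \<open>sw\<close> toggles the parity of \<open>s\<close>, and odd parity shortens. So exactly one of \<open>w\<close>
  and \<open>sw\<close> has the descent \<open>s\<close>; in particular multiplication by a generator always changes the length by one.\<close>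

lemma descent_iff_inversions:
  assumes "s \<in> S" "set l \<subseteq> S"
  shows "descent s (wp l) \<longleftrightarrow> inversions l s"
proof
  assume d: "descent s (wp l)"
  show "inversions l s"
  proof (rule ccontr)
    assume "\<not> inversions l s"
    then have "inversions (s # l) s" using assms by (simp add: inversions_Cons gen_in gen_sq)
    then have "descent s (wp (s # l))" using inversions_descent assms by (metis insert_subset list.set(2))
    then show False using d assms by (simp add: descent_def gen_cancel)
  qed
qed (use inversions_descent assms in blast)

lemma exchange:
  assumes "s \<in> S" "set l \<subseteq> S" "descent s (wp l)"
  obtains l1 t l2 where "l = l1 @ t # l2" "s \<otimes> wp l = wp (l1 @ l2)"
  using inversions_delete[of l s] descent_iff_inversions assms gen_in by blast

lemma len_descent:
  assumes "s \<in> S" "w \<in> carrier W" "descent s w"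
  shows "len w = len (s \<otimes> w) + 1"
  using len_gen_mult[of s "s \<otimes> w"] assms by (simp add: gen_cancel gen_in descent_def)

lemma len_not_descent:
  assumes "s \<in> S" "w \<in> carrier W" "\<not> descent s w"
  shows "len (s \<otimes> w) = len w + 1"
proof -
  obtain l where l: "is_reduced l" "wp l = w" using reduced_word_ex assms(2) by blast
  then have "\<not> inversions l s" using assms descent_iff_inversions by (auto simp: is_reduced_def)
  then have "inversions (s # l) s" using assms by (simp add: inversions_Cons gen_in gen_sq)
  then have "descent s (s \<otimes> w)" using inversions_descent[of s "s # l"] assms l by (simp add: is_reduced_def)
  then show ?thesis using len_descent[of s "s \<otimes> w"] assms by (simp add: gen_cancel gen_in)
qed

lemma descent_mult_gen:
  assumes "s \<in> S" "w \<in> carrier W"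
  shows "descent s (s \<otimes> w) \<longleftrightarrow> \<not> descent s w"
proof (cases "descent s w")
  case True
  then show ?thesis using gen_cancel[OF assms] by (simp add: descent_def)
next
  case False
  then show ?thesis using len_not_descent[OF assms] gen_cancel[OF assms] by (simp add: descent_def)
qed

lemma is_reduced_Cons: 
  assumes "s \<in> S" "set l \<subseteq> S"
  shows "is_reduced (s # l) \<longleftrightarrow> is_reduced l \<and> \<not> descent s (wp l)"
proof (cases "descent s (wp l)")
  case True
  then have "\<not> is_reduced (s # l)" using len_le[OF assms(2)] by (simp add: is_reduced_def descent_def)
  then show ?thesis using True by simp
next
  case False
  then show ?thesis using assms len_not_descent[OF assms(1) wp_closed[OF assms(2)]] by (simp add: is_reduced_def)
qed

section \<open>Elements with several descents\<close>

text \<open>If \<open>s\<close> and \<open>t\<close> did not commute, an element with both descents would begin with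
  alternating words in \<open>s\<close> and \<open>t\<close> of any length.\<close>

lemma two_descents_commute:
  assumes s: "s \<in> S" and t: "t \<in> S" and st: "s \<noteq> t" and u: "u \<in> carrier W"
    and ds: "descent s u" and dt: "descent t u"
  shows "m s t = 2"
proof (rule m_cases[OF s t])
  assume inf: "m s t = \<infinity>"
  have ts: "m t s = \<infinity>" using inf m_sym s t by simp
  \<comment> \<open>\<open>P k\<close> says that some reduced word of \<open>u\<close> starts with an alternating word of length \<open>k\<close>.\<close>
  define P where "P k \<longleftrightarrow> (\<exists>a b l. {a, b} = {s, t} \<and> a \<noteq> b \<and> set l \<subseteq> S \<and> wp (alternating a b k @ l) = u \<and>
     k + length l = len u)" for k
  have "\<exists>k. P k"
  proof -
    obtain l where "is_reduced l" "wp l = u" using reduced_word_ex[OF u] .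
    then have "{s, t} = {s, t} \<and> s \<noteq> t \<and> set l \<subseteq> S \<and> wp (alternating s t 0 @ l) = u \<and> 0 + length l = len u"
      unfolding is_reduced_def using st by auto
    then have "P 0" unfolding P_def by blast
    then show ?thesis by blast
  qed
  moreover have "\<forall>k. P k \<longrightarrow> k \<le> len u" by (auto simp: P_def)
  ultimately obtain k where k: "P k" and max: "\<And>k'. P k' \<Longrightarrow> k' \<le> k"
    by (metis GreatestI_nat Greatest_le_nat)
  obtain a b l where abl: "{a, b} = {s, t}" "a \<noteq> b" "set l \<subseteq> S" "wp (alternating a b k @ l) = u"
     "k + length l = len u" using k unfolding P_def by blast
  \<comment> \<open>The prefix starts with \<open>a\<close>, or is empty; the other letter \<open>b\<close> is a descent as well, and exchanging it
    deletes a letter \<open>c\<close> either inside the alternating prefix or behind it.\<close>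
  have ab: "a \<in> S" "b \<in> S" "m b a = \<infinity>" "descent b u"
    using abl(1,2) s t inf ts ds dt by (auto simp: doubleton_eq_iff)
  have alternating: "set (alternating a b k) \<subseteq> S" using alternating_in ab by blast
  have sub: "set (alternating a b k @ l) \<subseteq> S" using alternating abl(3) by simp
  obtain l1 c l2 where l12: "alternating a b k @ l = l1 @ c # l2" "b \<otimes> wp (alternating a b k @ l) = wp (l1 @ l2)"
    using exchange[OF ab(2) sub] abl(4) ab(4) by blast
  have l12S: "set l1 \<subseteq> S" "set l2 \<subseteq> S" "c \<in> S" using sub l12(1) by auto
  show ?thesis
  proof (cases "length l1 < k")
    case True
    define r where "r = l1 @ take (k - length l1 - 1) l2"
    have e: "alternating a b k = l1 @ c # take (k - length l1 - 1) l2" "l = drop (k - length l1 - 1) l2"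
    proof -
      have t: "take k (alternating a b k @ l) = take k (l1 @ c # l2)" "drop k (alternating a b k @ l) = drop k (l1 @ c # l2)"
        using l12(1) by simp_all
      obtain j where j: "k = length l1 + Suc j" using True less_imp_Suc_add by fastforce
      have "length (alternating a b k @ l) = length (l1 @ c # l2)" using l12(1) by simp
      then have "length l2 = j + length l" by (simp add: j)
      then show "alternating a b k = l1 @ c # take (k - length l1 - 1) l2" "l = drop (k - length l1 - 1) l2"
        using t by (simp_all add: j del: alternating.simps)
    qed
    have "l1 @ l2 = r @ l" unfolding r_def using e(2) by simp
    moreover have rS: "set r \<subseteq> S" unfolding r_def using l12S set_take_subset[of _ l2] by auto
    ultimately have "b \<otimes> wp (alternating a b k) \<otimes> wp l = wp r \<otimes> wp l"
      using l12(2) alternating abl(3) ab by (simp add: wp_append m_assoc gen_in)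
    then have "wp r = wp (alternating b a (Suc k))" using rS alternating abl(3) ab by (simp add: gen_in)
    \<comment> \<open>Deleting inside would express an alternating word of length \<open>k + 1\<close> by \<open>k - 1\<close> letters.\<close>
    from alternating_shortest[OF ab(2,1,3) rS this] have "Suc k \<le> length r" .
    moreover have "length (alternating a b k) = Suc (length r)" by (subst e(1)) (simp add: r_def)
    ultimately show ?thesis by simp
  next
    case False
    define r where "r = drop k l1 @ l2"
    have "take k (alternating a b k @ l) = take k (l1 @ c # l2)" "drop k (alternating a b k @ l) = drop k (l1 @ c # l2)"
      using l12(1) by simp_all
    then have e: "alternating a b k = take k l1" "l = drop k l1 @ c # l2" using False by simp_all
    have rS: "set r \<subseteq> S" unfolding r_def using l12S set_drop_subset[of k l1] by auto
    \<comment> \<open>Deleting behind it would produce a longer alternating prefix.\<close>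
    have "b \<otimes> u = wp (alternating a b k @ r)" using l12(2) abl(4) e(1) by (simp add: r_def flip: append_assoc)
    then have "u = b \<otimes> wp (alternating a b k @ r)" using gen_cancel[OF ab(2) u] by simp
    then have "wp (alternating b a (Suc k) @ r) = u" by simp
    moreover have "Suc k + length r = len u" using abl(5) e(2) by (simp add: r_def)
    moreover have "{b, a} = {s, t}" "b \<noteq> a" using abl(1,2) by blast+
    ultimately have "P (Suc k)" unfolding P_def using rS by blast
    then show ?thesis using max[of "Suc k"] by simp
  qed
qed (use st in auto)

text \<open>Two descents commute, so both can be cancelled, one after the other.\<close>

lemma two_descents:
  assumes s: "s \<in> S" and t: "t \<in> S" and st: "s \<noteq> t" and u: "u \<in> carrier W"
    and ds: "descent s u" and dt: "descent t u"
  shows "descent s (t \<otimes> u)"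
proof -
  have c: "s \<otimes> t = t \<otimes> s" using two_descents_commute[OF assms] gen_commute s t by blast
  obtain l where l: "is_reduced l" "wp l = s \<otimes> u" using reduced_word_ex[of "s \<otimes> u"] s u gen_in by blast
  have lS: "set l \<subseteq> S" using l by (simp add: is_reduced_def)
  have sl: "wp (s # l) = u" using l s u by (simp add: gen_cancel)
  have ll: "len u = length l + 1" using len_descent[OF s u ds] l by (simp add: is_reduced_def)
  have "set (s # l) \<subseteq> S" "descent t (wp (s # l))" using s lS sl dt by simp_all
  from exchange[OF t this] obtain l1 r l2 where e: "s # l = l1 @ r # l2" "t \<otimes> u = wp (l1 @ l2)"
    unfolding sl by blast
  show ?thesis
  proof (cases l1)
    case Nil
    then have "t \<otimes> u = s \<otimes> u" using e l by simp
    then show ?thesis using st s t u gen_in by simp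
  next
    case (Cons s' l1')
    then have "s' = s" "l = l1' @ r # l2" using e(1) by auto
    then have e2: "t \<otimes> u = s \<otimes> wp (l1' @ l2)" "set (l1' @ l2) \<subseteq> S" using e(2) Cons lS by auto
    then have "s \<otimes> (t \<otimes> u) = wp (l1' @ l2)" using gen_cancel[OF s wp_closed[OF e2(2)]] by simp
    then have "len (s \<otimes> (t \<otimes> u)) \<le> length l - 1"
      using len_le[of "l1' @ l2"] e2(2) \<open>l = _\<close> by simp
    moreover have "length l \<ge> 1" using \<open>l = _\<close> by simp
    moreover have "len (t \<otimes> u) = length l" using len_descent[OF t u dt] ll by simp
    ultimately show ?thesis by (simp add: descent_def)
  qed
qed

lemma commute_word:
  assumes "s \<in> S" "set l \<subseteq> S" "\<And>t. t \<in> set l \<Longrightarrow> s = t \<or> m s t = 2"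
  shows "s \<otimes> wp l = wp l \<otimes> s"
  using assms(2,3)
proof (induction l)
  case Nil
  then show ?case using assms(1) by (simp add: gen_in)
next
  case (Cons t l)
  have st: "s \<otimes> t = t \<otimes> s" using Cons.prems assms(1) gen_commute by (cases "s = t") auto
  have "s \<otimes> wp (t # l) = (s \<otimes> t) \<otimes> wp l" using Cons.prems assms(1) by (simp add: gen_in m_assoc)
  also have "\<dots> = t \<otimes> (s \<otimes> wp l)" using Cons.prems assms(1) st by (simp add: gen_in m_assoc)
  also have "\<dots> = wp (t # l) \<otimes> s" using Cons assms(1) by (simp add: gen_in m_assoc)
  finally show ?case .
qed

text \<open>The rigidity of right-angled groups: a descent of a reduced product that is not a descent of
  its left factor has to travel through this factor, so it commutes with all its letters, and \<open>m s t = 2\<close> also says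
  that it differs from them.\<close>

lemma descent_passes:
  assumes s: "s \<in> S" and "set l \<subseteq> S" and b: "b \<in> carrier W"
    and "len (wp l \<otimes> b) = length l + len b"
    and "descent s (wp l \<otimes> b)" and "\<not> descent s (wp l)"
  shows "(\<forall>t\<in>set l. m s t = 2) \<and> descent s b"
  using assms(2,4-)
proof (induction l)
  case Nil
  then show ?case using b by simp
next
  case (Cons t l)
  have t: "t \<in> S" "set l \<subseteq> S" using Cons.prems by auto
  let ?u1 = "wp l \<otimes> b"
  have u1: "?u1 \<in> carrier W" "wp (t # l) \<otimes> b = t \<otimes> ?u1" using t b by (simp_all add: gen_in m_assoc)
  have "len ?u1 \<le> length l + len b" using len_mult[of "wp l" b] len_le[of l] t b by simp
  moreover have "len (t \<otimes> ?u1) \<le> len ?u1 + 1" using len_gen_mult t u1 by simp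
  ultimately have lu1: "len ?u1 = length l + len b" using Cons.prems u1 by simp
  then have "len (t \<otimes> ?u1) = len ?u1 + 1" using Cons.prems u1 by simp
  then have dt: "descent t (t \<otimes> ?u1)" "\<not> descent t ?u1" using t u1 by (simp_all add: descent_def gen_cancel)
  have rw: "is_reduced (t # l)"
  proof -
    have "length (t # l) + len b \<le> len (wp (t # l)) + len b"
      using len_mult[of "wp (t # l)" b] Cons.prems b t by (simp add: gen_in)
    then show ?thesis using len_le[of "t # l"] Cons.prems by (simp add: is_reduced_def)
  qed
  then have "descent t (wp (t # l))" using is_reduced_Cons[OF t] descent_mult_gen[of t "wp l"] t by simp
  then have st: "s \<noteq> t" using Cons.prems(4) by metis
  have ds: "descent s (t \<otimes> ?u1)" using Cons.prems(3) by (simp only: u1(2))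
  have tu: "t \<otimes> ?u1 \<in> carrier W" using t(1) u1(1) by (simp add: gen_in)
  have mst: "m s t = 2" using two_descents_commute[OF s t(1) st tu ds dt(1)] .
  have c: "s \<otimes> t = t \<otimes> s" using gen_commute[OF s t(1) mst] .
  have ds1: "descent s ?u1" using two_descents[OF s t(1) st tu ds dt(1)] gen_cancel[OF t(1) u1(1)] by simp
  have "\<not> descent s (wp l)"
  proof
    assume "descent s (wp l)"
    then have "len (s \<otimes> wp l) + 1 = len (wp l)" using len_descent s t by simp
    moreover have "s \<otimes> wp (t # l) = t \<otimes> (s \<otimes> wp l)"
      using m_assoc[of s t "wp l"] m_assoc[of t s "wp l"] s t c by (simp add: gen_in)
    ultimately have "len (s \<otimes> wp (t # l)) \<le> len (wp l)" using len_gen_mult[of t "s \<otimes> wp l"] s t by (simp add: gen_in)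
    then have "descent s (wp (t # l))" using rw is_reduced_Cons[of t l] t by (simp add: is_reduced_def descent_def)
    then show False using Cons.prems by simp
  qed
  with Cons.IH t lu1 ds1 mst show ?case by simp
qed

section \<open>Prefixes of equal length\<close>

text \<open>No cancellation takes place between \<open>g\<close> and \<open>b\<close>; in other words, \<open>g\<close> is a prefix of \<open>g \<otimes> b\<close>.\<close>

definition reduced_product :: "'a \<Rightarrow> 'a \<Rightarrow> bool" where
  "reduced_product g b \<longleftrightarrow> g \<in> carrier W \<and> b \<in> carrier W \<and> len (g \<otimes> b) = len g + len b"

lemma descent_reduced_product:
  assumes s: "s \<in> S" and r: "reduced_product g b" and d: "descent s g"
  shows "descent s (g \<otimes> b)" "reduced_product (s \<otimes> g) b"
proof -
  have c: "g \<in> carrier W" "b \<in> carrier W" "s \<in> carrier W" using s r gen_in by (simp_all add: reduced_product_def)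
  have l: "len g = len (s \<otimes> g) + 1" using len_descent[OF s c(1) d] .
  have e: "s \<otimes> (g \<otimes> b) = s \<otimes> g \<otimes> b" using c by (simp add: m_assoc)
  have "len (s \<otimes> g \<otimes> b) \<le> len (s \<otimes> g) + len b" using len_mult c by simp
  moreover have "len (g \<otimes> b) = len g + len b" using r by (simp add: reduced_product_def)
  moreover have "len (g \<otimes> b) \<le> len (s \<otimes> (g \<otimes> b)) + 1"
    using len_gen_mult[OF s, of "s \<otimes> (g \<otimes> b)"] gen_cancel[OF s, of "g \<otimes> b"] c by simp
  ultimately show "descent s (g \<otimes> b)" "reduced_product (s \<otimes> g) b"
    unfolding descent_def reduced_product_def using l e c by simp_all
qed

text \<open>Two prefixes of one element that share no descent span a product: the first letter \<open>s\<close> of \<open>k\<close> is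
  a descent of the common element but not of \<open>wp l\<close>, so it passes through \<open>l\<close>, and can be
  removed from \<open>k\<close> and from the common element.\<close>

lemma prefixes_commute:
  assumes "is_reduced k" "is_reduced l" "reduced_product (wp k) b" "reduced_product (wp l) b'" "wp k \<otimes> b = wp l \<otimes> b'"
    and "\<And>s. s \<in> S \<Longrightarrow> descent s (wp k) \<Longrightarrow> \<not> descent s (wp l)"
  shows "\<forall>s\<in>set k. \<forall>t\<in>set l. m s t = 2"
  using assms
proof (induction k arbitrary: b b')
  case Nil
  then show ?case by simp
next
  case (Cons s k)
  have s: "s \<in> S" and k: "set k \<subseteq> S" and l: "set l \<subseteq> S" and b: "b \<in> carrier W" "b' \<in> carrier W"
    using Cons.prems(1-4) by (simp_all add: is_reduced_def reduced_product_def)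
  have sc: "s \<in> carrier W" using gen_in[OF s] .
  have rk: "is_reduced k" and nk: "\<not> descent s (wp k)" using is_reduced_Cons[OF s k] Cons.prems(1) by simp_all
  have dk: "descent s (wp (s # k))" using nk descent_mult_gen[OF s wp_closed[OF k]] by simp
  have nl: "\<not> descent s (wp l)" using Cons.prems(6)[OF s dk] .
  define u where "u = wp l \<otimes> b'"
  have u: "u \<in> carrier W" "wp (s # k) \<otimes> b = u" "len u = length l + len b'"
    using Cons.prems(2,4,5) l b by (simp_all add: u_def reduced_product_def is_reduced_def)
  have sk: "s \<otimes> wp (s # k) = wp k" using gen_cancel[OF s wp_closed[OF k]] by simp
  have du: "descent s u" and rpk: "reduced_product (wp k) b"
    using descent_reduced_product[OF s Cons.prems(3) dk] u(2) sk by simp_all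
  have p: "\<forall>t\<in>set l. m s t = 2" "descent s b'"
    using descent_passes[OF s l b(2) _ _ nl] u(3) du by (simp_all add: u_def)
  have "s \<otimes> u = wp k \<otimes> b" 
    unfolding u(2)[symmetric] using gen_cancel[OF s, of "wp k \<otimes> b"] wp_closed[OF k] b sc by (simp add: m_assoc)
  moreover have su: "s \<otimes> u = wp l \<otimes> (s \<otimes> b')"
  proof -
    have "s \<otimes> u = (s \<otimes> wp l) \<otimes> b'" unfolding u_def using wp_closed[OF l] b sc by (simp add: m_assoc)
    also have "s \<otimes> wp l = wp l \<otimes> s" using commute_word[OF s l] p(1) by blast
    finally show ?thesis using wp_closed[OF l] b sc by (simp add: m_assoc)
  qed
  ultimately have eq: "wp k \<otimes> b = wp l \<otimes> (s \<otimes> b')" by simp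
  have "len (wp l \<otimes> (s \<otimes> b')) + 1 = length l + len (s \<otimes> b') + 1"
    using len_descent[OF s u(1) du] u(3) len_descent[OF s b(2) p(2)] su by simp
  then have rpl: "reduced_product (wp l) (s \<otimes> b')"
    using Cons.prems(2) sc b wp_closed[OF l] by (simp add: reduced_product_def is_reduced_def)
  have nc: "\<not> descent t (wp l)" if t: "t \<in> S" "descent t (wp k)" for t
  proof
    assume dl: "descent t (wp l)"
    then have ts: "t \<noteq> s" using nl by metis
    have "descent t u" using descent_reduced_product(1)[OF t(1) Cons.prems(4) dl] by (simp add: u_def)
    then have "m t s = 2" using two_descents_commute[OF t(1) s ts u(1) _ du] by simp
    then have c: "t \<otimes> s = s \<otimes> t" using gen_commute[OF t(1) s] by simp
    have tc: "t \<in> carrier W" using gen_in[OF t(1)] .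
    have "t \<otimes> wp (s # k) = s \<otimes> (t \<otimes> wp k)"
      using m_assoc[OF tc sc wp_closed[OF k]] m_assoc[OF sc tc wp_closed[OF k]] c by simp
    then have "len (t \<otimes> wp (s # k)) \<le> len (wp k)"
      using len_gen_mult[OF s, of "t \<otimes> wp k"] len_descent[OF t(1) wp_closed[OF k] t(2)] tc wp_closed[OF k] by simp
    then have "descent t (wp (s # k))" using rk Cons.prems(1) by (simp add: descent_def is_reduced_def)
    then show False using Cons.prems(6)[OF t(1)] dl by simp
  qed
  show ?case using Cons.IH[OF rk Cons.prems(2) rpk rpl eq nc] p(1) by simp
qed

text \<open>A letter that occurs twice could be moved next to its other occurrence and cancelled.\<close>

lemma reduced_clique_distinct:
  assumes "is_reduced l" "\<And>s t. s \<in> set l \<Longrightarrow> t \<in> set l \<Longrightarrow> s \<noteq> t \<Longrightarrow> m s t = 2"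
  shows "distinct l"
  using assms
proof (induction l)
  case (Cons s l)
  have s: "s \<in> S" and l: "set l \<subseteq> S" using Cons.prems(1) by (simp_all add: is_reduced_def)
  have "s \<notin> set l"
  proof
    assume "s \<in> set l"
    then obtain p r where pr: "l = p @ s # r" by (meson split_list)
    have prS: "set p \<subseteq> S" "set r \<subseteq> S" using l pr by simp_all
    have "s \<otimes> wp p = wp p \<otimes> s" using commute_word[OF s prS(1)] Cons.prems(2)[of s] pr by fastforce
    then have "wp l = s \<otimes> wp p \<otimes> wp r"
      unfolding pr using prS s gen_in[OF s] by (simp add: wp_append m_assoc)
    then have "wp l = s \<otimes> wp (p @ r)" using prS gen_in[OF s] by (simp add: wp_append m_assoc)
    then have "wp (s # l) = wp (p @ r)" using gen_cancel[OF s, of "wp (p @ r)"] prS by simp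
    then have "len (wp (s # l)) \<le> length (p @ r)" using len_le[of "p @ r"] prS by simp
    then show False using Cons.prems(1) pr by (simp add: is_reduced_def)
  qed
  moreover have "distinct l" using Cons.IH Cons.prems is_reduced_Cons[OF s l] by simp
  ultimately show ?case by simp
qed simp

text \<open>A non-commuting pair in \<open>K\<close> and one in \<open>L\<close> form an induced square.\<close>

lemma no_square_clique:
  assumes ns: "\<not> has_induced_square S m" and KS: "K \<subseteq> S" "L \<subseteq> S"
    and KL: "\<forall>s\<in>K. \<forall>t\<in>L. m s t = 2"
  shows "(\<forall>s\<in>K. \<forall>t\<in>K. s \<noteq> t \<longrightarrow> m s t = 2) \<or> (\<forall>s\<in>L. \<forall>t\<in>L. s \<noteq> t \<longrightarrow> m s t = 2)"
proof (rule ccontr)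
  assume "\<not> ?thesis"
  then obtain a c b d where ac: "a \<in> K" "c \<in> K" "a \<noteq> c" "m a c \<noteq> 2" and bd: "b \<in> L" "d \<in> L" "b \<noteq> d" "m b d \<noteq> 2"
    by blast
  have S: "a \<in> S" "c \<in> S" "b \<in> S" "d \<in> S" using ac bd KS by auto
  have "m a c = \<infinity>" "m b d = \<infinity>" using m_cases[OF S(1,2)] m_cases[OF S(3,4)] ac bd by metis+
  moreover have "m a b = 2" "m b c = 2" "m c d = 2" "m d a = 2"
    using KL ac bd m_sym[OF S(3,2)] m_sym[OF S(4,1)] by simp_all
  ultimately have "has_induced_square S m" unfolding has_induced_square_def using S by blast
  then show False using ns by simp
qed

text \<open>This is where the absence of induced squares enters: after removing common descents, the
  remainders \<open>x\<close> and \<open>y\<close> of \<open>g\<close> and \<open>h\<close> commute letter by letter, so the letters of one of them form a clique.\<close>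

lemma prefixes_close:
  assumes ns: "\<not> has_induced_square S m" and fin: "finite S"
    and "reduced_product g b" "reduced_product h b'" "g \<otimes> b = h \<otimes> b'" "len g = len h"
  shows "\<exists>x\<in>carrier W. \<exists>y\<in>carrier W. h = g \<otimes> inv x \<otimes> y \<and> len x = len y \<and> len x \<le> card S"
  using assms(3-)
proof (induction "len g" arbitrary: g h rule: less_induct)
  case less
  have c: "g \<in> carrier W" "h \<in> carrier W" "b \<in> carrier W" "b' \<in> carrier W"
    using less.prems by (simp_all add: reduced_product_def)
  show ?case
  proof (cases "\<exists>s\<in>S. descent s g \<and> descent s h")
    case True
    then obtain s where s: "s \<in> S" "descent s g" "descent s h" by blast
    have sc: "s \<in> carrier W" using gen_in s by simp
    have l: "len (s \<otimes> g) < len g" "len (s \<otimes> g) = len (s \<otimes> h)"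
      using len_descent[OF s(1) c(1) s(2)] len_descent[OF s(1) c(2) s(3)] less.prems(4) by simp_all
    have e: "s \<otimes> g \<otimes> b = s \<otimes> h \<otimes> b'" using less.prems(3) c sc by (simp add: m_assoc)
    obtain x y where xy: "x \<in> carrier W" "y \<in> carrier W" "s \<otimes> h = s \<otimes> g \<otimes> inv x \<otimes> y"
        "len x = len y" "len x \<le> card S"
      using less.hyps[OF l(1) descent_reduced_product(2)[OF s(1) less.prems(1) s(2)]
        descent_reduced_product(2)[OF s(1) less.prems(2) s(3)] e l(2)] by blast
    have "s \<otimes> h = s \<otimes> (g \<otimes> inv x \<otimes> y)" using xy c sc by (simp add: m_assoc)
    then have "h = g \<otimes> inv x \<otimes> y" using xy c sc by simp
    then show ?thesis using xy by blast
  next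
    case False
    obtain k l where k: "is_reduced k" "wp k = g" and l: "is_reduced l" "wp l = h" using reduced_word_ex c by metis
    have comm: "\<forall>s\<in>set k. \<forall>t\<in>set l. m s t = 2"
      using prefixes_commute[OF k(1) l(1)] less.prems False k(2) l(2) by blast
    have S: "set k \<subseteq> S" "set l \<subseteq> S" and len: "length k = len g" "length l = len g"
      using k l less.prems(4) by (simp_all add: is_reduced_def)
    have "distinct k \<or> distinct l"
      using no_square_clique[OF ns S comm] reduced_clique_distinct[OF k(1)] reduced_clique_distinct[OF l(1)] by blast
    then have "len g \<le> card S"
      using S len distinct_card[of k] distinct_card[of l] card_mono[OF fin S(1)] card_mono[OF fin S(2)] by metis
    moreover have "h = g \<otimes> inv g \<otimes> h" using c by simp
    ultimately show ?thesis using c less.prems(4) by blast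
  qed
qed

lemma finite_ball: "finite S \<Longrightarrow> finite {z \<in> carrier W. len z \<le> k}"
proof -
  assume "finite S"
  then have "finite (wp ` {l. set l \<subseteq> S \<and> length l \<le> k})" by (simp add: finite_lists_length_le)
  moreover have "{z \<in> carrier W. len z \<le> k} \<subseteq> wp ` {l. set l \<subseteq> S \<and> length l \<le> k}"
  proof
    fix z assume z: "z \<in> {z \<in> carrier W. len z \<le> k}"
    then obtain l where "is_reduced l" "wp l = z" using reduced_word_ex by blast
    then show "z \<in> wp ` {l. set l \<subseteq> S \<and> length l \<le> k}" using z by (auto simp: is_reduced_def)
  qed
  ultimately show ?thesis using finite_subset by blast
qed

definition prefixes :: "nat \<Rightarrow> 'a \<Rightarrow> 'a set" where
  "prefixes k u = {g \<in> carrier W. len g = k \<and> reduced_product g (inv g \<otimes> u)}"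

text \<open>Without induced squares, prefixes of equal length of one element lie within distance \<open>2 * card S\<close> of each other, so a
  ball of this radius bounds their number.\<close>

definition fork_bound :: nat where
  "fork_bound = card {z \<in> carrier W. len z \<le> 2 * card S}"

lemma fork_bound_pos: "finite S \<Longrightarrow> fork_bound > 0"
  unfolding fork_bound_def by (intro card_gt_0_iff[THEN iffD2] conjI finite_ball) (auto intro: exI[of _ \<one>])

lemma finite_prefixes: "finite S \<Longrightarrow> finite (prefixes k u)"
  by (rule finite_subset[OF _ finite_ball[of k]]) (auto simp: prefixes_def)

lemma card_prefixes:
  assumes ns: "\<not> has_induced_square S m" and fin: "finite S" and u: "u \<in> carrier W"
  shows "card (prefixes k u) \<le> fork_bound"
proof (cases "prefixes k u = {}")
  case False
  then obtain g where g: "g \<in> prefixes k u" by blast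
  let ?Z = "{z \<in> carrier W. len z \<le> 2 * card S}"
  have "prefixes k u \<subseteq> (\<lambda>z. g \<otimes> z) ` ?Z"
  proof
    fix h assume h: "h \<in> prefixes k u"
    have gh: "g \<in> carrier W" "h \<in> carrier W" "len g = len h"
      "reduced_product g (inv g \<otimes> u)" "reduced_product h (inv h \<otimes> u)" using g h by (simp_all add: prefixes_def)
    have "g \<otimes> (inv g \<otimes> u) = h \<otimes> (inv h \<otimes> u)" using gh u by (simp flip: m_assoc)
    from prefixes_close[OF ns fin gh(4,5) this gh(3)] obtain x y where
      xy: "x \<in> carrier W" "y \<in> carrier W" "h = g \<otimes> inv x \<otimes> y" "len x = len y" "len x \<le> card S" by blast
    have "len (inv x \<otimes> y) \<le> 2 * card S" using len_mult[of "inv x" y] len_inv[of x] xy by simp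
    moreover have "h = g \<otimes> (inv x \<otimes> y)" using xy gh(1) by (simp add: m_assoc)
    ultimately show "h \<in> (\<lambda>z. g \<otimes> z) ` ?Z" using xy by blast
  qed
  then have "card (prefixes k u) \<le> card ((\<lambda>z. g \<otimes> z) ` ?Z)" using finite_ball[OF fin] by (simp add: card_mono)
  also have "\<dots> \<le> fork_bound" unfolding fork_bound_def using finite_ball[OF fin] by (rule card_image_le)
  finally show ?thesis .
qed simp

end

section \<open>The tripod inequality\<close>

lemma sum_fibres_le:
  fixes \<phi> :: "'w \<Rightarrow> real"
  assumes "finite A" "finite V" "\<pi> ` A \<subseteq> V" "\<And>w. w \<in> V \<Longrightarrow> card {p \<in> A. \<pi> p = w} \<le> N" "\<And>w. \<phi> w \<ge> 0"
  shows "(\<Sum>p\<in>A. \<phi> (\<pi> p)) \<le> real N * (\<Sum>w\<in>V. \<phi> w)"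
proof -
  have "(\<Sum>p\<in>A. \<phi> (\<pi> p)) = (\<Sum>w\<in>V. \<Sum>p\<in>{p \<in> A. \<pi> p = w}. \<phi> (\<pi> p))"
    using sum.group[OF assms(1-3), of "\<lambda>p. \<phi> (\<pi> p)"] by simp
  also have "\<dots> = (\<Sum>w\<in>V. real (card {p \<in> A. \<pi> p = w}) * \<phi> w)"
    by (intro sum.cong refl) simp
  also have "\<dots> \<le> (\<Sum>w\<in>V. real N * \<phi> w)"
    using assms(4,5) by (intro sum_mono mult_right_mono) auto
  finally show ?thesis by (simp add: sum_distrib_left)
qed

lemma sum_fibres_square_le:
  fixes F :: "'p \<Rightarrow> real"
  assumes "finite A" "finite V" "\<pi> ` A \<subseteq> V" "\<And>w. w \<in> V \<Longrightarrow> card {p \<in> A. \<pi> p = w} \<le> N"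
  shows "(\<Sum>w\<in>V. (\<Sum>p\<in>{p \<in> A. \<pi> p = w}. F p)\<^sup>2) \<le> real N * (\<Sum>p\<in>A. (F p)\<^sup>2)"
proof -
  have "(\<Sum>w\<in>V. (\<Sum>p\<in>{p \<in> A. \<pi> p = w}. F p)\<^sup>2) \<le> (\<Sum>w\<in>V. real N * (\<Sum>p\<in>{p \<in> A. \<pi> p = w}. (F p)\<^sup>2))"
  proof (rule sum_mono)
    fix w assume w: "w \<in> V"
    have "(\<Sum>p\<in>{p \<in> A. \<pi> p = w}. F p)\<^sup>2 \<le> (\<Sum>p\<in>{p \<in> A. \<pi> p = w}. (F p)\<^sup>2) * card {p \<in> A. \<pi> p = w}"
      using assms(1) by (simp add: sum_squared_le_sum_of_squares)
    also have "\<dots> \<le> (\<Sum>p\<in>{p \<in> A. \<pi> p = w}. (F p)\<^sup>2) * real N"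
      using assms(4)[OF w] by (intro mult_left_mono sum_nonneg) auto
    finally show "(\<Sum>p\<in>{p \<in> A. \<pi> p = w}. F p)\<^sup>2 \<le> real N * (\<Sum>p\<in>{p \<in> A. \<pi> p = w}. (F p)\<^sup>2)"
      by (simp add: mult.commute)
  qed
  also have "\<dots> = real N * (\<Sum>p\<in>A. (F p)\<^sup>2)"
    using sum.group[OF assms(1-3), of "\<lambda>p. (F p)\<^sup>2"] by (simp flip: sum_distrib_left)
  finally show ?thesis .
qed

text \<open>If \<open>R\<close> is a full product set, this says that the Hilbert--Schmidt norm of a product of two matrices is at
  most the product of their Hilbert--Schmidt norms. In general only the triples in \<open>R\<close> contribute, and the matrices
  are restricted to the pairs of indices that occur in \<open>R\<close>.\<close>

lemma tripod_hilbert_schmidt: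
  fixes f :: "'g \<times> 'a \<Rightarrow> real" and h :: "'a \<times> 'b \<Rightarrow> real" and R :: "('g \<times> 'a \<times> 'b) set"
  defines "ga \<equiv> \<lambda>(g, a, b). (g, a)" and "ab \<equiv> \<lambda>(g, a, b). (a, b)" and "gb \<equiv> \<lambda>(g, a, b). (g, b)"
  assumes fin: "finite R"
  shows "(\<Sum>t\<in>gb ` R. (\<Sum>r\<in>{r \<in> R. gb r = t}. f (ga r) * h (ab r))\<^sup>2)
    \<le> (\<Sum>p\<in>ga ` R. (f p)\<^sup>2) * (\<Sum>p\<in>ab ` R. (h p)\<^sup>2)"
proof -
  \<comment> \<open>\<open>F\<close> and \<open>H\<close> collect the squares in the rows of \<open>f\<close> and the columns of \<open>h\<close>.\<close>
  define F where "F g = (\<Sum>p\<in>{p \<in> ga ` R. fst p = g}. (f p)\<^sup>2)" for g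
  define H where "H b = (\<Sum>p\<in>{p \<in> ab ` R. snd p = b}. (h p)\<^sup>2)" for b
  have F0: "F g \<ge> 0" and H0: "H b \<ge> 0" for g b by (simp_all add: F_def H_def sum_nonneg)
  have fibre: "(\<Sum>r\<in>{r \<in> R. gb r = t}. f (ga r) * h (ab r))\<^sup>2 \<le> F (fst t) * H (snd t)" for t
  proof -
    let ?T = "{r \<in> R. gb r = t}"
    have inj: "inj_on ga ?T" "inj_on ab ?T"
      by (auto simp: inj_on_def ga_def gb_def ab_def split: prod.splits)
    have "(\<Sum>r\<in>?T. (f (ga r))\<^sup>2) = (\<Sum>p\<in>ga ` ?T. (f p)\<^sup>2)" by (simp add: sum.reindex[OF inj(1)])
    also have "\<dots> \<le> F (fst t)" unfolding F_def
      using fin by (intro sum_mono2) (force simp: ga_def gb_def)+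
    finally have 1: "(\<Sum>r\<in>?T. (f (ga r))\<^sup>2) \<le> F (fst t)" .
    have "(\<Sum>r\<in>?T. (h (ab r))\<^sup>2) = (\<Sum>p\<in>ab ` ?T. (h p)\<^sup>2)" by (simp add: sum.reindex[OF inj(2)])
    also have "\<dots> \<le> H (snd t)" unfolding H_def
      using fin by (intro sum_mono2) (force simp: ab_def gb_def)+
    finally have 2: "(\<Sum>r\<in>?T. (h (ab r))\<^sup>2) \<le> H (snd t)" .
    have "(\<Sum>r\<in>?T. f (ga r) * h (ab r))\<^sup>2 \<le> (\<Sum>r\<in>?T. (f (ga r))\<^sup>2) * (\<Sum>r\<in>?T. (h (ab r))\<^sup>2)"
      by (rule Cauchy_Schwarz_ineq_sum)
    also have "\<dots> \<le> F (fst t) * H (snd t)"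
      by (intro mult_mono 1 2 F0 sum_nonneg) simp
    finally show ?thesis .
  qed
  have "(\<Sum>t\<in>gb ` R. (\<Sum>r\<in>{r \<in> R. gb r = t}. f (ga r) * h (ab r))\<^sup>2) \<le> (\<Sum>t\<in>gb ` R. F (fst t) * H (snd t))"
    by (intro sum_mono fibre)
  also have "\<dots> \<le> (\<Sum>t\<in>(fst ` ga ` R) \<times> (snd ` ab ` R). F (fst t) * H (snd t))"
    using fin F0 H0 by (intro sum_mono2) (force simp: ga_def ab_def gb_def)+
  also have "\<dots> = (\<Sum>g\<in>fst ` ga ` R. F g) * (\<Sum>b\<in>snd ` ab ` R. H b)"
    by (simp add: sum_product sum.cartesian_product case_prod_unfold)
  also have "(\<Sum>g\<in>fst ` ga ` R. F g) = (\<Sum>p\<in>ga ` R. (f p)\<^sup>2)"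
    unfolding F_def using fin by (intro sum.group) auto
  also have "(\<Sum>b\<in>snd ` ab ` R. H b) = (\<Sum>p\<in>ab ` R. (h p)\<^sup>2)"
    unfolding H_def using fin by (intro sum.group) auto
  finally show ?thesis .
qed

text \<open>The maps \<open>\<omega>\<close>, \<open>\<nu>\<close>, \<open>\<upsilon>\<close> identify pairs of legs that join to the same point. As they are at most
  \<open>N\<close>-to-one, each of the three costs one factor \<open>N\<close> in the preceding inequality.\<close>

lemma tripod_bound:
  fixes x :: "'w \<Rightarrow> real" and y :: "'v \<Rightarrow> real" and R :: "('g \<times> 'a \<times> 'b) set"
    and \<omega> :: "'g \<times> 'a \<Rightarrow> 'w" and \<nu> :: "'a \<times> 'b \<Rightarrow> 'v" and \<upsilon> :: "'g \<times> 'b \<Rightarrow> 'u"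
  defines "ga \<equiv> \<lambda>(g, a, b). (g, a)" and "ab \<equiv> \<lambda>(g, a, b). (a, b)" and "gb \<equiv> \<lambda>(g, a, b). (g, b)"
  assumes fin: "finite R" "finite V" "finite Y" "finite U"
    and im: "\<omega> ` ga ` R \<subseteq> V" "\<nu> ` ab ` R \<subseteq> Y" "\<upsilon> ` gb ` R \<subseteq> U"
    and card: "\<And>w. w \<in> V \<Longrightarrow> card {p \<in> ga ` R. \<omega> p = w} \<le> N"
      "\<And>v. v \<in> Y \<Longrightarrow> card {p \<in> ab ` R. \<nu> p = v} \<le> N"
      "\<And>u. u \<in> U \<Longrightarrow> card {p \<in> gb ` R. \<upsilon> p = u} \<le> N"
  shows "(\<Sum>u\<in>U. (\<Sum>r\<in>{r \<in> R. \<upsilon> (gb r) = u}. x (\<omega> (ga r)) * y (\<nu> (ab r)))\<^sup>2)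
    \<le> real N ^ 3 * (\<Sum>w\<in>V. (x w)\<^sup>2) * (\<Sum>v\<in>Y. (y v)\<^sup>2)"
proof -
  let ?\<phi> = "\<lambda>r. x (\<omega> (ga r)) * y (\<nu> (ab r))"
  have "(\<Sum>r\<in>{r \<in> R. \<upsilon> (gb r) = u}. ?\<phi> r) = (\<Sum>t\<in>{t \<in> gb ` R. \<upsilon> t = u}. \<Sum>r\<in>{r \<in> R. gb r = t}. ?\<phi> r)" for u
  proof -
    have "(\<Sum>t\<in>{t \<in> gb ` R. \<upsilon> t = u}. \<Sum>r\<in>{r \<in> {r \<in> R. \<upsilon> (gb r) = u}. gb r = t}. ?\<phi> r)
        = (\<Sum>r\<in>{r \<in> R. \<upsilon> (gb r) = u}. ?\<phi> r)"
      using fin(1) by (intro sum.group) auto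
    moreover have "{r \<in> {r \<in> R. \<upsilon> (gb r) = u}. gb r = t} = {r \<in> R. gb r = t}" if "\<upsilon> t = u" for t
      using that by auto
    ultimately show ?thesis by simp
  qed
  then have "(\<Sum>u\<in>U. (\<Sum>r\<in>{r \<in> R. \<upsilon> (gb r) = u}. ?\<phi> r)\<^sup>2)
      \<le> real N * (\<Sum>t\<in>gb ` R. (\<Sum>r\<in>{r \<in> R. gb r = t}. ?\<phi> r)\<^sup>2)"
    using sum_fibres_square_le[OF _ fin(4) im(3) card(3)] fin(1) by simp
  also have "\<dots> \<le> real N * ((\<Sum>p\<in>ga ` R. (x (\<omega> p))\<^sup>2) * (\<Sum>p\<in>ab ` R. (y (\<nu> p))\<^sup>2))"
    using tripod_hilbert_schmidt[OF fin(1), of "\<lambda>p. x (\<omega> p)" "\<lambda>p. y (\<nu> p)"]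
    unfolding ga_def ab_def gb_def by (intro mult_left_mono) simp_all
  also have "\<dots> \<le> real N * ((real N * (\<Sum>w\<in>V. (x w)\<^sup>2)) * (real N * (\<Sum>v\<in>Y. (y v)\<^sup>2)))"
    using sum_fibres_le[OF _ fin(2) im(1) card(1), of "\<lambda>w. (x w)\<^sup>2"]
      sum_fibres_le[OF _ fin(3) im(2) card(2), of "\<lambda>v. (y v)\<^sup>2"] fin(1)
    by (intro mult_left_mono mult_mono) (simp_all add: sum_nonneg)
  finally show ?thesis by (simp add: power3_eq_cube algebra_simps)
qed

section \<open>Matrix coefficients of the Hecke operators\<close>

context racg
begin

text \<open>The operator of a word; for a reduced word of \<open>w\<close> it is the operator of the basis element \<open>w\<close>.\<close>

definition hecke_word :: "('a \<Rightarrow> real) \<Rightarrow> 'a list \<Rightarrow> ('a \<Rightarrow> complex) \<Rightarrow> 'a \<Rightarrow> complex" where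
  "hecke_word q l = foldr (\<lambda>s A. hecke_gen W S q s \<circ> A) l id"

lemma hecke_word_Nil [simp]: "hecke_word q [] \<xi> = \<xi>"
  by (simp add: hecke_word_def)

lemma hecke_word_Cons:
  assumes "u \<in> carrier W"
  shows "hecke_word q (s # l) \<xi> u = hecke_word q l \<xi> (s \<otimes> u) + (if descent s u then hecke_p q s * hecke_word q l \<xi> u else 0)"
  using assms by (simp add: hecke_word_def hecke_gen_def descent_def)

lemma hecke_word_linear:
  assumes F: "finite F" "\<And>v. v \<notin> F \<Longrightarrow> \<xi> v = 0" and l: "set l \<subseteq> S" and u: "u \<in> carrier W"
  shows "hecke_word q l \<xi> u = (\<Sum>v\<in>F. \<xi> v * hecke_word q l (delta v) u)"
  using l u
proof (induction l arbitrary: u)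
  case Nil
  then show ?case using F by (cases "u \<in> F") (simp_all add: delta_def if_distrib[of "\<lambda>x. _ * x"] cong: if_cong)
next
  case (Cons s l)
  then have "s \<otimes> u \<in> carrier W" using gen_in by simp
  then show ?case
    using Cons by (simp add: hecke_word_Cons sum.distrib sum_distrib_left algebra_simps)
qed

text \<open>Products of cliques are represented by words rather than by sets of letters: a kept letter
  is then simply put in front, and the same clique may be counted once for each ordering, which only affects the constant.\<close>

definition clique_words :: "'a list set" where
  "clique_words = {c. distinct c \<and> set c \<in> cliques S (graph_edges S m)}"

definition weight :: "('a \<Rightarrow> real) \<Rightarrow> 'a list \<Rightarrow> real" where
  "weight q c = (\<Prod>t\<in>set c. \<bar>hecke_p q t\<bar>)"

lemma weight_nonneg: "weight q c \<ge> 0"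
  by (simp add: weight_def prod_nonneg)

lemma clique_word_in: "c \<in> clique_words \<Longrightarrow> set c \<subseteq> S"
  by (simp add: clique_words_def cliques_def)

lemma clique_word_Cons:
  assumes "c \<in> clique_words" "s \<in> S" "\<forall>t\<in>set c. m s t = 2"
  shows "s # c \<in> clique_words" "weight q (s # c) = \<bar>hecke_p q s\<bar> * weight q c"
proof -
  have "s \<notin> set c" using assms(2,3) m_two_neq by blast
  moreover have "m t s = 2" if "t \<in> set c" for t
    using that assms m_sym[of t s] clique_word_in[OF assms(1)] by auto
  ultimately show "s # c \<in> clique_words" "weight q (s # c) = \<bar>hecke_p q s\<bar> * weight q c"
    using assms clique_word_in[OF assms(1)]
    by (auto simp: clique_words_def cliques_def graph_edges_def weight_def)
qed

text \<open>The splittings \<open>w = g k a\<close>, \<open>v = a\<^sup>-\<^sup>1 k\<^sup>-\<^sup>1 b\<close>, \<open>u = g k b\<close> with \<open>k\<close> the product of the clique word \<open>c\<close>, where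
  \<open>k\<^sup>-\<^sup>1 = k\<close> as the letters of a clique commute. The middle equation is solved for \<open>b\<close> to avoid inverses.\<close>

definition splittings :: "'a \<Rightarrow> 'a \<Rightarrow> 'a \<Rightarrow> ('a list \<times> 'a \<times> 'a \<times> 'a) set" where
  "splittings w v u = {(c, g, a, b). c \<in> clique_words \<and> g \<in> carrier W \<and> a \<in> carrier W \<and> b \<in> carrier W \<and>
     w = g \<otimes> (wp c \<otimes> a) \<and> b = wp c \<otimes> (a \<otimes> v) \<and> u = g \<otimes> (wp c \<otimes> b) \<and>
     len w = len g + length c + len a \<and> len v = len a + length c + len b \<and>
     len u = len g + length c + len b}"

text \<open>Here \<open>s\<close> is about to be multiplied to \<open>w\<close> and meets a copy of itself in \<open>u = g k b\<close>. Since
  \<open>g k\<close> is a prefix of \<open>w\<close>, which does not start with \<open>s\<close>, this copy stems from \<open>b\<close>.\<close>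

lemma splitting_passes:
  assumes s: "s \<in> S" and d: "(c, g, a, b) \<in> splittings w v u" and ns: "\<not> descent s w" and ds: "descent s u"
  shows "\<forall>t\<in>set c. m s t = 2" "descent s b" "\<not> descent s g"
    "s \<otimes> g = g \<otimes> s" "s \<otimes> wp c = wp c \<otimes> s"
proof -
  have cS: "set c \<subseteq> S" and C: "g \<in> carrier W" "a \<in> carrier W" "b \<in> carrier W"
    and w: "w = g \<otimes> (wp c \<otimes> a)" "len w = len g + length c + len a"
    and u: "u = g \<otimes> (wp c \<otimes> b)" "len u = len g + length c + len b"
    using d clique_word_in by (auto simp: splittings_def)
  have cC: "wp c \<in> carrier W" using wp_closed[OF cS] .
  obtain l where l: "is_reduced l" "wp l = g" using reduced_word_ex[OF C(1)] .
  have lS: "set l \<subseteq> S" "length l = len g" using l by (auto simp: is_reduced_def)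
  have lcS: "set (l @ c) \<subseteq> S" using lS cS by simp
  have wlc: "wp (l @ c) = g \<otimes> wp c" using wp_append[OF lS(1) cS] l by simp
  have w': "w = wp (l @ c) \<otimes> a" and u': "u = wp (l @ c) \<otimes> b" using w u wlc C cC by (simp_all add: m_assoc)
  have "len (wp (l @ c)) \<le> length (l @ c)" using len_le[OF lcS] .
  moreover have "len w \<le> len (wp (l @ c)) + len a" unfolding w' using len_mult lcS C by simp
  ultimately have lenlc: "len (wp (l @ c)) = len g + length c" using w(2) lS by simp
  have r: "reduced_product (wp (l @ c)) a" using w' w(2) lenlc wp_closed[OF lcS] C by (simp add: reduced_product_def)
  have nlc: "\<not> descent s (wp (l @ c))" using descent_reduced_product(1)[OF s r] ns w' by blast
  have "reduced_product g (wp c)" using wlc lenlc C cC len_mult[OF C(1) cC] len_le[OF cS] by (simp add: reduced_product_def)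
  then show ng: "\<not> descent s g" using descent_reduced_product(1)[OF s, of g "wp c"] nlc wlc by auto
  have p: "(\<forall>t\<in>set (l @ c). m s t = 2) \<and> descent s b"
    using descent_passes[OF s lcS C(3) _ _ nlc] u(2) ds u' lS by simp
  then show "\<forall>t\<in>set c. m s t = 2" "descent s b" by simp_all
  show "s \<otimes> g = g \<otimes> s" using commute_word[OF s lS(1)] p l(2) by auto
  show "s \<otimes> wp c = wp c \<otimes> s" using commute_word[OF s cS] p by auto
qed

text \<open>The letter \<open>s\<close> lengthens the vector: it joins the leg \<open>g\<close>.\<close>

lemma splitting_left:
  assumes s: "s \<in> S" and w: "w \<in> carrier W" and ns: "\<not> descent s w" and u: "u \<in> carrier W" and ds: "descent s u"
    and d: "(c, g, a, b) \<in> splittings w v (s \<otimes> u)"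
  shows "(c, s \<otimes> g, a, b) \<in> splittings (s \<otimes> w) v u" "descent s (s \<otimes> g)"
proof -
  have sc: "s \<in> carrier W" using gen_in[OF s] .
  have c: "c \<in> clique_words" "g \<in> carrier W" "a \<in> carrier W" "b \<in> carrier W" "wp c \<in> carrier W"
    and e: "w = g \<otimes> (wp c \<otimes> a)" "b = wp c \<otimes> (a \<otimes> v)" "s \<otimes> u = g \<otimes> (wp c \<otimes> b)"
    and l: "len w = len g + length c + len a" "len v = len a + length c + len b"
      "len (s \<otimes> u) = len g + length c + len b"
    using d wp_closed[OF clique_word_in] by (auto simp: splittings_def)
  have "u = s \<otimes> (s \<otimes> u)" using gen_cancel[OF s u] by simp
  then have eu: "u = s \<otimes> g \<otimes> (wp c \<otimes> b)" unfolding e(3) using c sc by (simp add: m_assoc)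
  have ew: "s \<otimes> w = s \<otimes> g \<otimes> (wp c \<otimes> a)" unfolding e(1) using c sc by (simp add: m_assoc)
  have lw: "len (s \<otimes> w) = len w + 1" using len_not_descent[OF s w ns] .
  have "len (s \<otimes> w) \<le> len (s \<otimes> g) + (len (wp c) + len a)"
    unfolding ew using len_mult[of "s \<otimes> g" "wp c \<otimes> a"] len_mult[of "wp c" a] c sc by simp
  then have "len (s \<otimes> g) \<ge> len g + 1" using lw l(1) len_le[OF clique_word_in[OF c(1)]] by simp
  then have lg: "len (s \<otimes> g) = len g + 1" using len_gen_mult[OF s c(2)] by simp
  then show "descent s (s \<otimes> g)" using gen_cancel[OF s c(2)] by (simp add: descent_def)
  have "len u = len (s \<otimes> u) + 1" using len_descent[OF s u ds] .
  then show "(c, s \<otimes> g, a, b) \<in> splittings (s \<otimes> w) v u"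
    unfolding splittings_def using c sc eu ew e(2) l lg lw by simp
qed

text \<open>The letter \<open>s\<close> is kept, with factor \<open>p\<^sub>s\<close>: it leaves \<open>b\<close> and joins the clique.\<close>

lemma splitting_middle:
  assumes s: "s \<in> S" and w: "w \<in> carrier W" and ns: "\<not> descent s w" and ds: "descent s u" and v: "v \<in> carrier W"
    and d: "(c, g, a, b) \<in> splittings w v u"
  shows "(s # c, g, a, s \<otimes> b) \<in> splittings (s \<otimes> w) v u" "\<not> descent s g"
    "weight q (s # c) = \<bar>hecke_p q s\<bar> * weight q c"
proof -
  have sc: "s \<in> carrier W" using gen_in[OF s] .
  have c: "c \<in> clique_words" "g \<in> carrier W" "a \<in> carrier W" "b \<in> carrier W" "wp c \<in> carrier W"
    and e: "w = g \<otimes> (wp c \<otimes> a)" "b = wp c \<otimes> (a \<otimes> v)" "u = g \<otimes> (wp c \<otimes> b)"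
    and l: "len w = len g + length c + len a" "len v = len a + length c + len b"
      "len u = len g + length c + len b"
    using d wp_closed[OF clique_word_in] by (auto simp: splittings_def)
  note p = splitting_passes[OF s d ns ds]
  show "\<not> descent s g" using p(3) .
  show "weight q (s # c) = \<bar>hecke_p q s\<bar> * weight q c" using clique_word_Cons(2)[OF c(1) s p(1)] .
  have "s \<otimes> w = (s \<otimes> g) \<otimes> (wp c \<otimes> a)" unfolding e(1) using c sc by (simp add: m_assoc)
  then have ew: "s \<otimes> w = g \<otimes> (wp (s # c) \<otimes> a)" unfolding p(4) using c sc by (simp add: m_assoc)
  have eb: "s \<otimes> b = wp (s # c) \<otimes> (a \<otimes> v)" unfolding e(2) using c sc v by (simp add: m_assoc)
  have "wp (s # c) \<otimes> (s \<otimes> b) = wp c \<otimes> (s \<otimes> (s \<otimes> b))"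
    using c sc p(5) by (simp add: m_assoc)
  then have "wp (s # c) \<otimes> (s \<otimes> b) = wp c \<otimes> b" using gen_cancel[OF s c(4)] by simp
  then have eu: "u = g \<otimes> (wp (s # c) \<otimes> (s \<otimes> b))" using e(3) by simp
  have "len b = len (s \<otimes> b) + 1" using len_descent[OF s c(4) p(2)] .
  moreover have "len (s \<otimes> w) = len w + 1" using len_not_descent[OF s w ns] .
  moreover have "s \<otimes> b \<in> carrier W" using sc c by simp
  ultimately show "(s # c, g, a, s \<otimes> b) \<in> splittings (s \<otimes> w) v u"
    unfolding splittings_def using c sc eu ew eb l clique_word_Cons(1)[OF c(1) s p(1)] by simp
qed

text \<open>The letter \<open>s\<close> cancels: it leaves \<open>b\<close> and joins the leg \<open>a\<close>.\<close>

lemma splitting_right: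
  assumes s: "s \<in> S" and w: "w \<in> carrier W" and ns: "\<not> descent s w" and u: "u \<in> carrier W" and nu: "\<not> descent s u"
    and v: "v \<in> carrier W" and d: "(c, g, a, b) \<in> splittings w v (s \<otimes> u)"
  shows "(c, g, s \<otimes> a, s \<otimes> b) \<in> splittings (s \<otimes> w) v u"
proof -
  have sc: "s \<in> carrier W" using gen_in[OF s] .
  have c: "c \<in> clique_words" "g \<in> carrier W" "a \<in> carrier W" "b \<in> carrier W" "wp c \<in> carrier W"
    and e: "w = g \<otimes> (wp c \<otimes> a)" "b = wp c \<otimes> (a \<otimes> v)" "s \<otimes> u = g \<otimes> (wp c \<otimes> b)"
    and l: "len w = len g + length c + len a" "len v = len a + length c + len b"
      "len (s \<otimes> u) = len g + length c + len b"
    using d wp_closed[OF clique_word_in] by (auto simp: splittings_def)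
  have dsu: "descent s (s \<otimes> u)" using descent_mult_gen[OF s u] nu by simp
  note p = splitting_passes[OF s d ns dsu]
  have pass: "s \<otimes> (g \<otimes> (wp c \<otimes> x)) = g \<otimes> (wp c \<otimes> (s \<otimes> x))" if x: "x \<in> carrier W" for x
  proof -
    have "s \<otimes> (g \<otimes> (wp c \<otimes> x)) = (s \<otimes> g) \<otimes> (wp c \<otimes> x)" using c sc x by (simp add: m_assoc)
    also have "\<dots> = g \<otimes> ((s \<otimes> wp c) \<otimes> x)" unfolding p(4) using c sc x by (simp add: m_assoc)
    also have "\<dots> = g \<otimes> (wp c \<otimes> (s \<otimes> x))" unfolding p(5) using c sc x by (simp add: m_assoc)
    finally show ?thesis .
  qed
  have ew: "s \<otimes> w = g \<otimes> (wp c \<otimes> (s \<otimes> a))" unfolding e(1) using pass[OF c(3)] .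
  have "u = s \<otimes> (s \<otimes> u)" using gen_cancel[OF s u] by simp
  then have eu: "u = g \<otimes> (wp c \<otimes> (s \<otimes> b))" unfolding e(3) using pass[OF c(4)] by simp
  have "s \<otimes> b = (s \<otimes> wp c) \<otimes> (a \<otimes> v)" unfolding e(2) using c sc v by (simp add: m_assoc)
  then have eb: "s \<otimes> b = wp c \<otimes> (s \<otimes> a \<otimes> v)" unfolding p(5) using c sc v by (simp add: m_assoc)
  have lb: "len b = len (s \<otimes> b) + 1" using len_descent[OF s c(4) p(2)] .
  have lw: "len (s \<otimes> w) = len w + 1" using len_not_descent[OF s w ns] .
  have lu: "len (s \<otimes> u) = len u + 1" using len_not_descent[OF s u nu] .
  have "len (s \<otimes> w) \<le> len g + (len (wp c) + len (s \<otimes> a))"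
    unfolding ew using len_mult[of g "wp c \<otimes> (s \<otimes> a)"] len_mult[of "wp c" "s \<otimes> a"] c sc by simp
  then have "len (s \<otimes> a) = len a + 1"
    using lw l(1) len_le[OF clique_word_in[OF c(1)]] len_gen_mult[OF s c(3)] by simp
  moreover have "s \<otimes> b \<in> carrier W" using sc c by simp
  ultimately show ?thesis
    unfolding splittings_def using c sc eu ew eb l lb lw lu by simp
qed

lemma finite_clique_words: "finite S \<Longrightarrow> finite clique_words"
  by (rule finite_subset[OF _ finite_subset_distinct[of S]]) (auto simp: clique_words_def cliques_def)

lemma finite_splittings:
  assumes "finite S"
  shows "finite (splittings w v u)"
proof -
  let ?B = "{z \<in> carrier W. len z \<le> len w + len v}"
  have "finite (clique_words \<times> ?B \<times> ?B \<times> ?B)"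
    using finite_ball[OF assms] finite_clique_words[OF assms] by blast
  then show ?thesis by (rule finite_subset[rotated]) (auto simp: splittings_def)
qed

definition split_sum :: "('a \<Rightarrow> real) \<Rightarrow> 'a \<Rightarrow> 'a \<Rightarrow> 'a \<Rightarrow> real" where
  "split_sum q w v u = (\<Sum>d\<in>splittings w v u. weight q (fst d))"

text \<open>The sum of the weights dominates the recursion of the matrix coefficients. The three ways to extend a
  splitting by \<open>s\<close> are injective, and the two that occur together if \<open>s\<close> is a descent of \<open>u\<close> have disjoint
  ranges, as they are told apart by whether the new leg \<open>g\<close> starts with \<open>s\<close>.\<close>

lemma split_sum_step:
  assumes fin: "finite S" and s: "s \<in> S" and w: "w \<in> carrier W" and ns: "\<not> descent s w"
    and u: "u \<in> carrier W" and v: "v \<in> carrier W"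
  shows "split_sum q w v (s \<otimes> u) + (if descent s u then \<bar>hecke_p q s\<bar> * split_sum q w v u else 0)
    \<le> split_sum q (s \<otimes> w) v u"
proof -
  let ?D = "splittings (s \<otimes> w) v u"
  have finD: "finite ?D" using finite_splittings[OF fin] .
  have C: "g \<in> carrier W \<and> a \<in> carrier W \<and> b \<in> carrier W" if "(c, g, a, b) \<in> splittings w v u'" for c g a b u'
    using that unfolding splittings_def by blast
  show ?thesis
  proof (cases "descent s u")
    case True
    define L where "L = (\<lambda>(c :: 'a list, g, a :: 'a, b :: 'a). (c, s \<otimes> g, a, b))"
    define M where "M = (\<lambda>(c, g :: 'a, a :: 'a, b). (s # c, g, a, s \<otimes> b))"
    have injL: "inj_on L (splittings w v (s \<otimes> u))"
    proof (rule inj_onI)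
      fix d e assume "d \<in> splittings w v (s \<otimes> u)" "e \<in> splittings w v (s \<otimes> u)" "L d = L e"
      moreover obtain c g a b where "d = (c, g, a, b)" by (cases d)
      moreover obtain c' g' a' b' where "e = (c', g', a', b')" by (cases e)
      ultimately show "d = e" using C[of c g a b] C[of c' g' a' b'] gen_in[OF s] by (simp add: L_def)
    qed
    have injM: "inj_on M (splittings w v u)"
    proof (rule inj_onI)
      fix d e assume "d \<in> splittings w v u" "e \<in> splittings w v u" "M d = M e"
      moreover obtain c g a b where "d = (c, g, a, b)" by (cases d)
      moreover obtain c' g' a' b' where "e = (c', g', a', b')" by (cases e)
      ultimately show "d = e" using C[of c g a b] C[of c' g' a' b'] gen_in[OF s] by (simp add: M_def)
    qed
    have L: "L d \<in> ?D \<and> descent s (fst (snd (L d))) \<and> fst (L d) = fst d" if "d \<in> splittings w v (s \<otimes> u)" for d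
      using that splitting_left[OF s w ns u True] by (cases d) (auto simp: L_def)
    have M: "M d \<in> ?D \<and> \<not> descent s (fst (snd (M d))) \<and> weight q (fst (M d)) = \<bar>hecke_p q s\<bar> * weight q (fst d)"
      if "d \<in> splittings w v u" for d
      using that splitting_middle[OF s w ns True v] by (cases d) (auto simp: M_def)
    have "split_sum q w v (s \<otimes> u) = (\<Sum>d\<in>L ` splittings w v (s \<otimes> u). weight q (fst d))"
      unfolding split_sum_def sum.reindex[OF injL] using L by simp
    moreover have "\<bar>hecke_p q s\<bar> * split_sum q w v u = (\<Sum>d\<in>M ` splittings w v u. weight q (fst d))"
      unfolding split_sum_def sum.reindex[OF injM] sum_distrib_left using M by simp
    moreover have "L ` splittings w v (s \<otimes> u) \<inter> M ` splittings w v u = {}"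
    proof (rule equals0I)
      fix x assume "x \<in> L ` splittings w v (s \<otimes> u) \<inter> M ` splittings w v u"
      then obtain d e where "d \<in> splittings w v (s \<otimes> u)" "x = L d" "e \<in> splittings w v u" "x = M e" by blast
      then show False using L[of d] M[of e] by simp
    qed
    then have "(\<Sum>d\<in>L ` splittings w v (s \<otimes> u). weight q (fst d)) + (\<Sum>d\<in>M ` splittings w v u. weight q (fst d))
       = (\<Sum>d\<in>L ` splittings w v (s \<otimes> u) \<union> M ` splittings w v u. weight q (fst d))"
      using finite_splittings[OF fin] by (simp add: sum.union_disjoint)
    moreover have "\<dots> \<le> split_sum q (s \<otimes> w) v u"
      unfolding split_sum_def using L M by (intro sum_mono2[OF finD]) (blast, simp add: weight_nonneg)
    ultimately show ?thesis using True by simp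
  next
    case False
    define A where "A = (\<lambda>(c :: 'a list, g :: 'a, a, b). (c, g, s \<otimes> a, s \<otimes> b))"
    have injA: "inj_on A (splittings w v (s \<otimes> u))"
    proof (rule inj_onI)
      fix d e assume "d \<in> splittings w v (s \<otimes> u)" "e \<in> splittings w v (s \<otimes> u)" "A d = A e"
      moreover obtain c g a b where "d = (c, g, a, b)" by (cases d)
      moreover obtain c' g' a' b' where "e = (c', g', a', b')" by (cases e)
      ultimately show "d = e" using C[of c g a b] C[of c' g' a' b'] gen_in[OF s] by (simp add: A_def)
    qed
    have A: "A d \<in> ?D \<and> fst (A d) = fst d" if "d \<in> splittings w v (s \<otimes> u)" for d
      using that splitting_right[OF s w ns u False v] by (cases d) (auto simp: A_def)
    have "split_sum q w v (s \<otimes> u) = (\<Sum>d\<in>A ` splittings w v (s \<otimes> u). weight q (fst d))"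
      unfolding split_sum_def sum.reindex[OF injA] using A by simp
    also have "\<dots> \<le> split_sum q (s \<otimes> w) v u"
      unfolding split_sum_def using A by (intro sum_mono2[OF finD]) (blast, simp add: weight_nonneg)
    finally show ?thesis using False by simp
  qed
qed

lemma hecke_word_bound:
  assumes fin: "finite S" and l: "is_reduced l" and v: "v \<in> carrier W" and u: "u \<in> carrier W"
  shows "cmod (hecke_word q l (delta v) u) \<le> split_sum q (wp l) v u"
  using l u
proof (induction l arbitrary: u)
  case Nil
  show ?case
  proof (cases "u = v")
    case True
    have "([], \<one>, \<one>, v) \<in> splittings \<one> v v"
      using v by (simp add: splittings_def clique_words_def cliques_def)
    then have "weight q (fst ([] :: 'a list, \<one>, \<one>, v)) \<le> split_sum q \<one> v v"
      unfolding split_sum_def using finite_splittings[OF fin] weight_nonneg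
      by (intro member_le_sum[of _ _ "\<lambda>d. weight q (fst d)"]) simp_all
    then show ?thesis using True by (simp add: weight_def delta_def)
  qed (simp add: delta_def split_sum_def sum_nonneg weight_nonneg)
next
  case (Cons s l)
  have s: "s \<in> S" and lS: "set l \<subseteq> S" using Cons.prems(1) by (simp_all add: is_reduced_def)
  have rl: "is_reduced l" and ns: "\<not> descent s (wp l)" using is_reduced_Cons[OF s lS] Cons.prems(1) by simp_all
  have su: "s \<otimes> u \<in> carrier W" using gen_in[OF s] Cons.prems(2) by simp
  have "cmod (hecke_word q (s # l) (delta v) u) \<le> cmod (hecke_word q l (delta v) (s \<otimes> u)) +
      (if descent s u then \<bar>hecke_p q s\<bar> * cmod (hecke_word q l (delta v) u) else 0)"
    unfolding hecke_word_Cons[OF Cons.prems(2)] by (rule order_trans[OF norm_triangle_ineq]) (simp add: norm_mult)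
  also have "\<dots> \<le> split_sum q (wp l) v (s \<otimes> u) + (if descent s u then \<bar>hecke_p q s\<bar> * split_sum q (wp l) v u else 0)"
    using Cons.IH[OF rl su] Cons.IH[OF rl Cons.prems(2)] by (intro add_mono) (auto intro: mult_left_mono)
  also have "\<dots> \<le> split_sum q (wp (s # l)) v u"
    using split_sum_step[OF fin s wp_closed[OF lS] ns Cons.prems(2) v] by simp
  finally show ?case .
qed

section \<open>Tripods of prescribed lengths\<close>

definition word_sphere :: "nat \<Rightarrow> 'a set" where
  "word_sphere n = {w \<in> carrier W. len w = n}"

lemma finite_word_sphere: "finite S \<Longrightarrow> finite (word_sphere n)"
  by (rule finite_subset[OF _ finite_ball[of n]]) (auto simp: word_sphere_def)

lemma hecke_T_eq_hecke_word:
  assumes "w \<in> carrier W"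
  obtains l where "is_reduced l" "wp l = w" "hecke_T W S q w = hecke_word q l"
proof -
  have "reduced_word W S w l \<longleftrightarrow> is_reduced l \<and> wp l = w" for l
    by (auto simp: reduced_word_def is_reduced_def)
  moreover obtain l where "is_reduced l" "wp l = w" using reduced_word_ex[OF assms] .
  ultimately have "reduced_word W S w (SOME l. reduced_word W S w l)"
    by (metis someI_ex)
  then have "is_reduced (SOME l. reduced_word W S w l)" "wp (SOME l. reduced_word W S w l) = w"
    by (auto simp: reduced_word_def is_reduced_def)
  then show ?thesis using that by (simp add: hecke_T_def hecke_word_def)
qed

lemma weight_le_hecke_const:
  assumes "finite S" "c \<in> clique_words"
  shows "weight q c \<le> hecke_const S m q"
proof -
  have "finite (cliques S (graph_edges S m))"
    by (rule finite_subset[of _ "Pow S"]) (auto simp: cliques_def assms(1))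
  then show ?thesis
    unfolding weight_def hecke_const_def using assms(2) by (intro Max_ge) (auto simp: clique_words_def)
qed

lemma empty_clique_word: "[] \<in> clique_words"
  by (simp add: clique_words_def cliques_def)

lemma hecke_const_ge_one: "finite S \<Longrightarrow> hecke_const S m q \<ge> 1"
  using weight_le_hecke_const[OF _ empty_clique_word, of q] by (simp add: weight_def)

lemma hecke_T_bound:
  assumes fin: "finite S" and "w \<in> carrier W" "v \<in> carrier W" "u \<in> carrier W"
  shows "cmod (hecke_T W S q w (delta v) u) \<le> hecke_const S m q * real (card (splittings w v u))"
proof -
  obtain l where l: "is_reduced l" "wp l = w" "hecke_T W S q w = hecke_word q l" using hecke_T_eq_hecke_word assms(2) .
  have "cmod (hecke_T W S q w (delta v) u) \<le> split_sum q w v u"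
    using hecke_word_bound[OF fin l(1) assms(3,4)] l by simp
  also have "\<dots> \<le> (\<Sum>d\<in>splittings w v u. hecke_const S m q)"
    unfolding split_sum_def
    by (intro sum_mono weight_le_hecke_const[OF fin]) (auto simp: splittings_def)
  finally show ?thesis by (simp add: mult.commute)
qed

text \<open>Two legs of a tripod with centre \<open>c\<close> are joined to a point: \<open>leg_join\<close> yields the arguments \<open>w = g k a\<close>
  and \<open>u = g k b\<close>, \<open>leg_turn\<close> the argument \<open>v = a\<^sup>-\<^sup>1 k\<^sup>-\<^sup>1 b\<close>, for which the leg \<open>a\<close> is run through backwards.\<close>

definition leg_join :: "'a list \<Rightarrow> 'a \<times> 'a \<Rightarrow> 'a" where "leg_join c = (\<lambda>(g, a). g \<otimes> (wp c \<otimes> a))"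
definition leg_turn :: "'a list \<Rightarrow> 'a \<times> 'a \<Rightarrow> 'a" where "leg_turn c = (\<lambda>(a, b). inv a \<otimes> (inv (wp c) \<otimes> b))"

definition tripods :: "nat \<Rightarrow> nat \<Rightarrow> nat \<Rightarrow> 'a list \<Rightarrow> ('a \<times> 'a \<times> 'a) set" where
  "tripods i j n c = {(g, a, b). g \<in> carrier W \<and> a \<in> carrier W \<and> b \<in> carrier W \<and>
     len (leg_join c (g, a)) = n \<and> n = len g + length c + len a \<and>
     len (leg_turn c (a, b)) = j \<and> j = len a + length c + len b \<and>
     len (leg_join c (g, b)) = i \<and> i = len g + length c + len b}"

lemma finite_tripods:
  assumes "finite S" shows "finite (tripods i j n c)"
proof -
  let ?B = "{z \<in> carrier W. len z \<le> i + j + n}"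
  have "finite (?B \<times> ?B \<times> ?B)" using finite_ball[OF assms] by blast
  then show ?thesis by (rule finite_subset[rotated]) (auto simp: tripods_def)
qed

lemma prefix_of_product:
  assumes "g \<in> carrier W" "y \<in> carrier W" "len (g \<otimes> y) = len g + p" "len y \<le> p"
  shows "g \<in> prefixes (len g) (g \<otimes> y)"
proof -
  have "inv g \<otimes> (g \<otimes> y) = y" using assms by (simp flip: m_assoc)
  then show ?thesis using assms len_mult[of g y] by (simp add: prefixes_def reduced_product_def)
qed

lemma card_fibre_le:
  assumes ns: "\<not> has_induced_square S m" and fin: "finite S" and u: "u \<in> carrier W"
    and F: "\<And>p. p \<in> F \<Longrightarrow> f p \<in> prefixes k u" "inj_on f F"
  shows "card F \<le> fork_bound"
  using card_inj_on_le[OF F(2) _ finite_prefixes[OF fin]] card_prefixes[OF ns fin u] F(1) order_trans by blast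

lemma len_clique_mult:
  assumes "c \<in> clique_words" "y \<in> carrier W"
  shows "len (wp c \<otimes> y) \<le> length c + len y" "len (inv (wp c) \<otimes> y) \<le> length c + len y"
  using len_mult[of "wp c" y] len_mult[of "inv (wp c)" y] len_le[of c] len_inv[of "wp c"]
    clique_word_in[OF assms(1)] assms(2) by simp_all

lemma leg_join_fibre:
  assumes c: "c \<in> clique_words" and C: "g \<in> carrier W" "a \<in> carrier W"
    and l: "len (leg_join c (g, a)) = len g + length c + len a"
  shows "g \<in> prefixes (len g) (leg_join c (g, a))"
  using prefix_of_product[OF C(1), of "wp c \<otimes> a" "length c + len a"] len_clique_mult(1)[OF c C(2)] l C(2)
    wp_closed[OF clique_word_in[OF c]] by (simp add: leg_join_def)

lemma leg_turn_fibre: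
  assumes c: "c \<in> clique_words" and C: "a \<in> carrier W" "b \<in> carrier W"
    and l: "len (leg_turn c (a, b)) = len a + length c + len b"
  shows "inv a \<in> prefixes (len a) (leg_turn c (a, b))"
  using prefix_of_product[OF inv_closed[OF C(1)], of "inv (wp c) \<otimes> b" "length c + len b"]
    len_clique_mult(2)[OF c C(2)] l C wp_closed[OF clique_word_in[OF c]] len_inv[OF C(1)]
  by (simp add: leg_turn_def)

lemma leg_join_inj:
  assumes "c \<in> clique_words" "g \<in> carrier W" "a \<in> carrier W" "a' \<in> carrier W" "leg_join c (g, a) = leg_join c (g, a')"
  shows "a = a'"
  using assms wp_closed[OF clique_word_in[OF assms(1)]] by (simp add: leg_join_def)

lemma leg_turn_inj:
  assumes "c \<in> clique_words" "a \<in> carrier W" "b \<in> carrier W" "b' \<in> carrier W" "leg_turn c (a, b) = leg_turn c (a, b')"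
  shows "b = b'"
  using assms wp_closed[OF clique_word_in[OF assms(1)]] by (simp add: leg_turn_def)

lemma card_leg_join_fibre:
  assumes ns: "\<not> has_induced_square S m" and fin: "finite S" and c: "c \<in> clique_words"
    and w: "w \<in> carrier W"
    and F: "\<And>g a. (g, a) \<in> F \<Longrightarrow> g \<in> carrier W \<and> a \<in> carrier W \<and> len g = k \<and>
      leg_join c (g, a) = w \<and> len w = len g + length c + len a"
  shows "card F \<le> fork_bound"
proof (rule card_fibre_le[OF ns fin w])
  fix p assume p: "p \<in> F"
  obtain g a where "p = (g, a)" by (cases p)
  then show "fst p \<in> prefixes k w" using leg_join_fibre[OF c, of g a] F[of g a] p by simp
next
  show "inj_on fst F"
  proof (rule inj_onI)
    fix p p' assume p: "p \<in> F" "p' \<in> F" "fst p = fst p'"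
    obtain g a where e: "p = (g, a)" by (cases p)
    obtain a' where e': "p' = (g, a')" using p(3) e by (cases p') simp
    show "p = p'" using leg_join_inj[OF c, of g a a'] F[of g a] F[of g a'] p(1,2) unfolding e e' by simp
  qed
qed

text \<open>Here it is \<open>inv a\<close> that is a prefix of \<open>v\<close>.\<close>

lemma card_leg_turn_fibre:
  assumes ns: "\<not> has_induced_square S m" and fin: "finite S" and c: "c \<in> clique_words"
    and v: "v \<in> carrier W"
    and F: "\<And>a b. (a, b) \<in> F \<Longrightarrow> a \<in> carrier W \<and> b \<in> carrier W \<and> len a = k \<and>
      leg_turn c (a, b) = v \<and> len v = len a + length c + len b"
  shows "card F \<le> fork_bound"
proof (rule card_fibre_le[OF ns fin v])
  fix p assume p: "p \<in> F"
  obtain a b where "p = (a, b)" by (cases p)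
  then show "inv (fst p) \<in> prefixes k v" using leg_turn_fibre[OF c, of a b] F[of a b] p by simp
next
  show "inj_on (\<lambda>p. inv (fst p)) F"
  proof (rule inj_onI)
    fix p p' assume p: "p \<in> F" "p' \<in> F" "inv (fst p) = inv (fst p')"
    obtain a b where e: "p = (a, b)" by (cases p)
    obtain a' b' where e': "p' = (a', b')" by (cases p')
    have "a = a'" using p(3) F[of a b] F[of a' b'] p(1,2) unfolding e e' by (metis fst_conv inv_inv)
    then show "p = p'" using leg_turn_inj[OF c, of a b b'] F[of a b] F[of a' b'] p(1,2) unfolding e e' by simp
  qed
qed

text \<open>For a fixed clique word, \<open>i\<close>, \<open>j\<close> and \<open>n\<close> determine the lengths of the three legs, so a leg of each of the three
  pairs (the inverse of \<open>a\<close> for the pair \<open>(a, b)\<close>) is a prefix of prescribed length of the point that the pair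
  represents, and determines the other leg.\<close>

lemma clique_block_bound:
  fixes x y :: "'a \<Rightarrow> real"
  assumes ns: "\<not> has_induced_square S m" and fin: "finite S" and c: "c \<in> clique_words"
  shows "(\<Sum>u\<in>word_sphere i. (\<Sum>(g, a, b)\<in>{(g, a, b) \<in> tripods i j n c. leg_join c (g, b) = u}.
      x (leg_join c (g, a)) * y (leg_turn c (a, b)))\<^sup>2)
    \<le> real fork_bound ^ 3 * (\<Sum>w\<in>word_sphere n. (x w)\<^sup>2) * (\<Sum>v\<in>word_sphere j. (y v)\<^sup>2)"
proof -
  let ?R = "tripods i j n c"
  let ?ga = "\<lambda>(g :: 'a, a :: 'a, b :: 'a). (g, a)" and ?ab = "\<lambda>(g :: 'a, a :: 'a, b :: 'a). (a, b)"
    and ?gb = "\<lambda>(g :: 'a, a :: 'a, b :: 'a). (g, b)"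
  note cC = wp_closed[OF clique_word_in[OF c]]
  have R: "g \<in> carrier W \<and> a \<in> carrier W \<and> b \<in> carrier W \<and>
     leg_join c (g, a) \<in> word_sphere n \<and> leg_turn c (a, b) \<in> word_sphere j \<and> leg_join c (g, b) \<in> word_sphere i \<and>
     n = len g + length c + len a \<and> j = len a + length c + len b \<and> i = len g + length c + len b \<and>
     len g = (n + i - j - length c) div 2 \<and> len a = (n + j - i - length c) div 2"
    if r: "(g, a, b) \<in> ?R" for g a b
  proof -
    have C: "g \<in> carrier W" "a \<in> carrier W" "b \<in> carrier W" and
      l: "len (leg_join c (g, a)) = n" "n = len g + length c + len a"
       "len (leg_turn c (a, b)) = j" "j = len a + length c + len b"
       "len (leg_join c (g, b)) = i" "i = len g + length c + len b" using r by (simp_all add: tripods_def)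
    have legs: "leg_join c (g, a) \<in> carrier W" "leg_join c (g, b) \<in> carrier W" "leg_turn c (a, b) \<in> carrier W"
      using C cC by (simp_all add: leg_join_def leg_turn_def)
    have "n + i - j - length c = 2 * len g" "n + j - i - length c = 2 * len a"
      unfolding l(2) l(4) l(6) by simp_all
    then have "len g = (n + i - j - length c) div 2" "len a = (n + j - i - length c) div 2" by simp_all
    then show ?thesis
      unfolding word_sphere_def mem_Collect_eq using C legs l by blast
  qed
  have "(\<Sum>u\<in>word_sphere i. (\<Sum>r\<in>{r \<in> ?R. leg_join c (?gb r) = u}. x (leg_join c (?ga r)) * y (leg_turn c (?ab r)))\<^sup>2)
    \<le> real fork_bound ^ 3 * (\<Sum>w\<in>word_sphere n. (x w)\<^sup>2) * (\<Sum>v\<in>word_sphere j. (y v)\<^sup>2)"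
  proof (rule tripod_bound)
    show "leg_join c ` ?ga ` ?R \<subseteq> word_sphere n" "leg_turn c ` ?ab ` ?R \<subseteq> word_sphere j" "leg_join c ` ?gb ` ?R \<subseteq> word_sphere i"
      using R by (simp_all add: image_subset_iff split_paired_all)
    show "card {p \<in> ?ga ` ?R. leg_join c p = w} \<le> fork_bound" if w: "w \<in> word_sphere n" for w
    proof (rule card_leg_join_fibre[OF ns fin c])
      fix g a assume "(g, a) \<in> {p \<in> ?ga ` ?R. leg_join c p = w}"
      then obtain b where "(g, a, b) \<in> ?R" "leg_join c (g, a) = w" by force
      then show "g \<in> carrier W \<and> a \<in> carrier W \<and> len g = (n + i - j - length c) div 2 \<and>
         leg_join c (g, a) = w \<and> len w = len g + length c + len a"
        using R w unfolding word_sphere_def mem_Collect_eq by metis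
    qed (use w in \<open>simp add: word_sphere_def\<close>)
    show "card {p \<in> ?gb ` ?R. leg_join c p = w} \<le> fork_bound" if w: "w \<in> word_sphere i" for w
    proof (rule card_leg_join_fibre[OF ns fin c])
      fix g b assume "(g, b) \<in> {p \<in> ?gb ` ?R. leg_join c p = w}"
      then obtain a where "(g, a, b) \<in> ?R" "leg_join c (g, b) = w" by force
      then show "g \<in> carrier W \<and> b \<in> carrier W \<and> len g = (n + i - j - length c) div 2 \<and>
         leg_join c (g, b) = w \<and> len w = len g + length c + len b"
        using R w unfolding word_sphere_def mem_Collect_eq by metis
    qed (use w in \<open>simp add: word_sphere_def\<close>)
    show "card {p \<in> ?ab ` ?R. leg_turn c p = v} \<le> fork_bound" if v: "v \<in> word_sphere j" for v
    proof (rule card_leg_turn_fibre[OF ns fin c])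
      fix a b assume "(a, b) \<in> {p \<in> ?ab ` ?R. leg_turn c p = v}"
      then obtain g where "(g, a, b) \<in> ?R" "leg_turn c (a, b) = v" by force
      then show "a \<in> carrier W \<and> b \<in> carrier W \<and> len a = (n + j - i - length c) div 2 \<and>
         leg_turn c (a, b) = v \<and> len v = len a + length c + len b"
        using R v unfolding word_sphere_def mem_Collect_eq by metis
    qed (use v in \<open>simp add: word_sphere_def\<close>)
  qed (simp_all add: finite_tripods finite_word_sphere fin)
  moreover have "(\<Sum>(g, a, b)\<in>{(g, a, b) \<in> ?R. leg_join c (g, b) = u}. x (leg_join c (g, a)) * y (leg_turn c (a, b)))
    = (\<Sum>r\<in>{r \<in> ?R. leg_join c (?gb r) = u}. x (leg_join c (?ga r)) * y (leg_turn c (?ab r)))" for u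
    by (intro sum.cong) auto
  ultimately show ?thesis by simp
qed

text \<open>Sorting the splittings by their clique word instead of by \<open>w\<close> and \<open>v\<close>.\<close>

lemma splittings_sum:
  fixes x y :: "'a \<Rightarrow> real"
  assumes fin: "finite S" and u: "u \<in> word_sphere i"
  shows "(\<Sum>w\<in>word_sphere n. \<Sum>v\<in>word_sphere j. x w * y v * real (card (splittings w v u)))
    = (\<Sum>c\<in>clique_words. \<Sum>(g, a, b)\<in>{(g, a, b) \<in> tripods i j n c. leg_join c (g, b) = u}.
        x (leg_join c (g, a)) * y (leg_turn c (a, b)))"
proof -
  let ?Rc = "\<lambda>c. {(g, a, b) \<in> tripods i j n c. leg_join c (g, b) = u}"
  let ?Q = "Sigma clique_words ?Rc"
  let ?\<omega> = "\<lambda>(c, g, a, b). (leg_join c (g, a), leg_turn c (a, b))"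
  let ?\<psi> = "\<lambda>(c, g, a, b). x (leg_join c (g, a)) * y (leg_turn c (a, b))"
  have finR: "finite (?Rc c)" for c by (rule finite_subset[OF _ finite_tripods[OF fin]]) auto
  have spl: "splittings w v u = {d \<in> ?Q. ?\<omega> d = (w, v)}" if w: "w \<in> word_sphere n" and v: "v \<in> word_sphere j" for w v
  proof (rule equalityI; rule subsetI)
    fix d assume "d \<in> splittings w v u"
    moreover obtain c g a b where d: "d = (c, g, a, b)" by (cases d)
    ultimately have "(c, g, a, b) \<in> splittings w v u" by simp
    then have s: "c \<in> clique_words" "g \<in> carrier W" "a \<in> carrier W" "b \<in> carrier W"
      "w = g \<otimes> (wp c \<otimes> a)" "b = wp c \<otimes> (a \<otimes> v)" "u = g \<otimes> (wp c \<otimes> b)"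
      "len w = len g + length c + len a" "len v = len a + length c + len b"
      "len u = len g + length c + len b"
      unfolding splittings_def mem_Collect_eq prod.case by blast+
    have cC: "wp c \<in> carrier W" using wp_closed[OF clique_word_in[OF s(1)]] .
    have vC: "v \<in> carrier W" using v by (simp add: word_sphere_def)
    have "inv (wp c) \<otimes> b = a \<otimes> v" unfolding s(6) using cC s(3) vC by (simp flip: m_assoc)
    then have lv: "leg_turn c (a, b) = v" using s(3) vC by (simp add: leg_turn_def flip: m_assoc)
    have lw: "leg_join c (g, a) = w" "leg_join c (g, b) = u" using s(5,7) by (simp_all add: leg_join_def)
    have "(g, a, b) \<in> tripods i j n c"
      using s(2-4,8-10) lv lw w v u by (simp add: tripods_def word_sphere_def)
    then show "d \<in> {d \<in> ?Q. ?\<omega> d = (w, v)}" using d s(1) lv lw by simp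
  next
    fix d assume a: "d \<in> {d \<in> ?Q. ?\<omega> d = (w, v)}"
    moreover obtain c g a b where d: "d = (c, g, a, b)" by (cases d)
    ultimately have s: "c \<in> clique_words" "(g, a, b) \<in> tripods i j n c" "leg_join c (g, b) = u"
      "leg_join c (g, a) = w" "leg_turn c (a, b) = v" by simp_all
    have C: "g \<in> carrier W" "a \<in> carrier W" "b \<in> carrier W" and
      l: "len w = len g + length c + len a" "len v = len a + length c + len b" "len u = len g + length c + len b"
      using s(2) unfolding s(3,4,5)[symmetric] by (simp_all add: tripods_def)
    have cC: "wp c \<in> carrier W" using wp_closed[OF clique_word_in[OF s(1)]] .
    have "a \<otimes> v = inv (wp c) \<otimes> b" using s(5) C cC by (auto simp: leg_turn_def simp flip: m_assoc)
    then have "wp c \<otimes> (a \<otimes> v) = b" using C cC by (simp flip: m_assoc)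
    then show "d \<in> splittings w v u"
      using d s C l by (simp add: splittings_def leg_join_def)
  qed
  have "(\<Sum>w\<in>word_sphere n. \<Sum>v\<in>word_sphere j. x w * y v * real (card (splittings w v u)))
    = (\<Sum>(w, v)\<in>word_sphere n \<times> word_sphere j. \<Sum>d\<in>{d \<in> ?Q. ?\<omega> d = (w, v)}. ?\<psi> d)"
    unfolding sum.cartesian_product
  proof (intro sum.cong refl, clarify)
    fix w v assume "w \<in> word_sphere n" "v \<in> word_sphere j"
    from spl[OF this] have "(\<Sum>d\<in>{d \<in> ?Q. ?\<omega> d = (w, v)}. ?\<psi> d) = (\<Sum>d\<in>splittings w v u. ?\<psi> d)" by simp
    also have "\<dots> = (\<Sum>d\<in>splittings w v u. x w * y v)"
      unfolding spl[OF \<open>w \<in> word_sphere n\<close> \<open>v \<in> word_sphere j\<close>] by (intro sum.cong) auto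
    finally show "x w * y v * real (card (splittings w v u)) = (\<Sum>d\<in>{d \<in> ?Q. ?\<omega> d = (w, v)}. ?\<psi> d)" by simp
  qed
  also have "\<dots> = (\<Sum>p\<in>word_sphere n \<times> word_sphere j. \<Sum>d\<in>{d \<in> ?Q. ?\<omega> d = p}. ?\<psi> d)"
    by (intro sum.cong refl) auto
  also have "\<dots> = sum ?\<psi> ?Q"
  proof (rule sum.group)
    show "finite ?Q" using finite_clique_words[OF fin] finR by (intro finite_SigmaI)
    show "finite (word_sphere n \<times> word_sphere j)" using finite_word_sphere[OF fin] by simp
    show "?\<omega> ` ?Q \<subseteq> word_sphere n \<times> word_sphere j"
      by (auto simp: tripods_def word_sphere_def leg_join_def leg_turn_def wp_closed[OF clique_word_in])
  qed
  also have "\<dots> = (\<Sum>c\<in>clique_words. \<Sum>r\<in>?Rc c. ?\<psi> (c, r))"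
    by (subst sum.Sigma) (use finite_clique_words[OF fin] finR in \<open>auto intro!: sum.cong\<close>)
  also have "\<dots> = (\<Sum>c\<in>clique_words. \<Sum>(g, a, b)\<in>?Rc c. x (leg_join c (g, a)) * y (leg_turn c (a, b)))"
    by (intro sum.cong refl) auto
  finally show ?thesis .
qed

lemma splittings_bound:
  fixes x y :: "'a \<Rightarrow> real"
  assumes ns: "\<not> has_induced_square S m" and fin: "finite S"
  shows "(\<Sum>u\<in>word_sphere i. (\<Sum>w\<in>word_sphere n. \<Sum>v\<in>word_sphere j. x w * y v * real (card (splittings w v u)))\<^sup>2)
    \<le> (real (card clique_words) * real fork_bound ^ 2)\<^sup>2 * (\<Sum>w\<in>word_sphere n. (x w)\<^sup>2) * (\<Sum>v\<in>word_sphere j. (y v)\<^sup>2)"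
proof -
  let ?M = "real (card clique_words)" and ?N = "real fork_bound"
  let ?P = "(\<Sum>w\<in>word_sphere n. (x w)\<^sup>2) * (\<Sum>v\<in>word_sphere j. (y v)\<^sup>2)"
  let ?f = "\<lambda>c u. \<Sum>(g, a, b)\<in>{(g, a, b) \<in> tripods i j n c. leg_join c (g, b) = u}.
        x (leg_join c (g, a)) * y (leg_turn c (a, b))"
  have "(\<Sum>u\<in>word_sphere i. (\<Sum>w\<in>word_sphere n. \<Sum>v\<in>word_sphere j. x w * y v * real (card (splittings w v u)))\<^sup>2)
     = (\<Sum>u\<in>word_sphere i. (\<Sum>c\<in>clique_words. ?f c u)\<^sup>2)"
    using splittings_sum[OF fin] by (intro sum.cong refl) simp
  also have "\<dots> \<le> (\<Sum>u\<in>word_sphere i. ?M * (\<Sum>c\<in>clique_words. (?f c u)\<^sup>2))"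
    using sum_squared_le_sum_of_squares
    by (intro sum_mono) (simp add: mult.commute)
  also have "\<dots> = ?M * (\<Sum>c\<in>clique_words. \<Sum>u\<in>word_sphere i. (?f c u)\<^sup>2)"
    by (simp add: sum_distrib_left[symmetric] sum.swap[of _ "word_sphere i"])
  also have "\<dots> \<le> ?M * (\<Sum>c\<in>clique_words. ?N ^ 3 * ?P)"
    using clique_block_bound[OF ns fin] by (intro mult_left_mono sum_mono) (simp_all add: mult.assoc)
  also have "\<dots> = ?M\<^sup>2 * ?N ^ 3 * ?P" by (simp add: power2_eq_square)
  \<comment> \<open>An even power keeps the square root of the constant free of radicals.\<close>
  also have "\<dots> \<le> ?M\<^sup>2 * ?N ^ 4 * ?P"
    using fork_bound_pos[OF fin] by (intro mult_right_mono mult_left_mono power_increasing) (simp_all add: sum_nonneg mult_nonneg_nonneg)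
  also have "\<dots> = (?M * ?N ^ 2)\<^sup>2 * ?P" by (simp add: power_mult_distrib flip: power_mult)
  finally show ?thesis by (simp add: mult.assoc)
qed

section \<open>The Haagerup inequality\<close>

lemma ell2_norm_finite:
  assumes "finite F" "F \<subseteq> carrier W" "\<And>v. v \<notin> F \<Longrightarrow> f v = 0"
  shows "(ell2_norm W f)\<^sup>2 = (\<Sum>v\<in>F. (cmod (f v))\<^sup>2)"
proof -
  have "(\<Sum>\<^sub>\<infinity>v\<in>carrier W. (cmod (f v))\<^sup>2) = (\<Sum>\<^sub>\<infinity>v\<in>F. (cmod (f v))\<^sup>2)"
    using assms by (intro infsum_cong_neutral) auto
  then show ?thesis using assms(1) by (simp add: ell2_norm_def sum_nonneg)
qed

lemma ell2_norm_nonneg: "ell2_norm W f \<ge> 0"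
  unfolding ell2_norm_def by (simp add: infsum_nonneg)

lemma ell2_partial_sum:
  assumes "f \<in> ell2 W" "finite F" "F \<subseteq> carrier W"
  shows "(\<Sum>v\<in>F. (cmod (f v))\<^sup>2) \<le> (ell2_norm W f)\<^sup>2"
proof -
  have "(\<Sum>v\<in>F. (cmod (f v))\<^sup>2) \<le> (\<Sum>\<^sub>\<infinity>v\<in>carrier W. (cmod (f v))\<^sup>2)"
    using assms by (intro finite_sum_le_infsum) (auto simp: ell2_def)
  then show ?thesis by (simp add: ell2_norm_def infsum_nonneg)
qed

lemma chi_support:
  assumes "x \<in> chi W S n ` hecke_algebra W"
  shows "{w. x w \<noteq> 0} \<subseteq> word_sphere n"
proof
  fix w assume w: "w \<in> {w. x w \<noteq> 0}"
  obtain y where y: "y \<in> hecke_algebra W" "x = chi W S n y" using assms by blast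
  then have "len w = n" "y w \<noteq> 0" using w by (simp_all add: chi_def split: if_split_asm)
  then show "w \<in> word_sphere n" using y(1) by (auto simp: hecke_algebra_def word_sphere_def)
qed

lemma hecke_op_sphere:
  assumes fin: "finite S" and x: "{w. x w \<noteq> 0} \<subseteq> word_sphere n"
  shows "hecke_op W S q x \<xi> u = (\<Sum>w\<in>word_sphere n. x w * hecke_T W S q w \<xi> u)"
  unfolding hecke_op_def by (intro sum.mono_neutral_left finite_word_sphere fin x) auto

lemma hecke_op_delta_one:
  assumes fin: "finite S" and x: "{w. x w \<noteq> 0} \<subseteq> word_sphere n"
  shows "hecke_op W S q x (delta \<one>) = x"
proof
  fix u
  have "hecke_op W S q x (delta \<one>) u = (\<Sum>w\<in>word_sphere n. x w * delta w u)"
    unfolding hecke_op_sphere[OF assms]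
    by (intro sum.cong refl) (simp add: hecke_T_delta_one[OF cox] word_sphere_def)
  also have "\<dots> = x u"
    using finite_word_sphere[OF fin] x by (cases "u \<in> word_sphere n") (auto simp: delta_def if_distrib[of "\<lambda>y. _ * y"] cong: if_cong)
  finally show "hecke_op W S q x (delta \<one>) u = x u" .
qed

lemma hecke_op_sphere_proj:
  assumes fin: "finite S" and x: "{w. x w \<noteq> 0} \<subseteq> word_sphere n" and u: "u \<in> carrier W"
  shows "hecke_op W S q x (sphere_proj W S j \<xi>) u =
    (\<Sum>w\<in>word_sphere n. \<Sum>v\<in>word_sphere j. x w * \<xi> v * hecke_T W S q w (delta v) u)"
  unfolding hecke_op_sphere[OF fin x]
proof (intro sum.cong refl)
  fix w assume "w \<in> word_sphere n"
  then have "w \<in> carrier W" by (simp add: word_sphere_def)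
  then obtain l where l: "is_reduced l" "hecke_T W S q w = hecke_word q l" using hecke_T_eq_hecke_word by metis
  have "hecke_word q l (sphere_proj W S j \<xi>) u = (\<Sum>v\<in>word_sphere j. sphere_proj W S j \<xi> v * hecke_word q l (delta v) u)"
    using finite_word_sphere[OF fin] l(1) u
    by (intro hecke_word_linear) (auto simp: sphere_proj_def word_sphere_def is_reduced_def)
  also have "\<dots> = (\<Sum>v\<in>word_sphere j. \<xi> v * hecke_word q l (delta v) u)"
    by (intro sum.cong refl) (simp add: sphere_proj_def word_sphere_def)
  finally show "x w * hecke_T W S q w (sphere_proj W S j \<xi>) u =
     (\<Sum>v\<in>word_sphere j. x w * \<xi> v * hecke_T W S q w (delta v) u)"
    by (simp add: l(2) sum_distrib_left mult.assoc)
qed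

text \<open>The constant depends only on the Coxeter system; the parameters enter through \<open>hecke_const\<close> alone, which dominates the
  weight of every clique.\<close>

lemma haagerup_inequality:
  assumes ns: "\<not> has_induced_square S m" and fin: "finite S"
    and x: "x \<in> chi W S n ` hecke_algebra W"
  shows "op_norm W (sphere_proj W S i \<circ> hecke_op W S q x \<circ> sphere_proj W S j)
    \<le> ereal (real (card clique_words) * real fork_bound ^ 2 * hecke_const S m q *
         ell2_norm W (hecke_op W S q x (delta \<one>)))"
  unfolding op_norm_def
proof (rule SUP_least)
  fix \<xi> assume "\<xi> \<in> {\<xi> \<in> ell2 W. ell2_norm W \<xi> \<le> 1}"
  then have \<xi>: "\<xi> \<in> ell2 W" "ell2_norm W \<xi> \<le> 1" by simp_all
  note sup = chi_support[OF x]
  let ?K = "real (card clique_words) * real fork_bound ^ 2" and ?C = "hecke_const S m q"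
  let ?f = "(sphere_proj W S i \<circ> hecke_op W S q x \<circ> sphere_proj W S j) \<xi>"
  let ?s = "\<lambda>u. \<Sum>w\<in>word_sphere n. \<Sum>v\<in>word_sphere j. cmod (x w) * cmod (\<xi> v) * real (card (splittings w v u))"
  have sph: "word_sphere k \<subseteq> carrier W" for k by (auto simp: word_sphere_def)
  have C: "?C \<ge> 0" using hecke_const_ge_one[OF fin, of q] by simp
  have pt: "cmod (?f u) \<le> ?C * ?s u" if u: "u \<in> word_sphere i" for u
  proof -
    have uC: "u \<in> carrier W" using u by (simp add: word_sphere_def)
    have "?f u = (\<Sum>w\<in>word_sphere n. \<Sum>v\<in>word_sphere j. x w * \<xi> v * hecke_T W S q w (delta v) u)"
      using u hecke_op_sphere_proj[OF fin sup uC, of q j \<xi>] by (simp add: sphere_proj_def word_sphere_def)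
    also have "cmod \<dots> \<le> (\<Sum>w\<in>word_sphere n. \<Sum>v\<in>word_sphere j. cmod (x w) * cmod (\<xi> v) * cmod (hecke_T W S q w (delta v) u))"
      by (intro order_trans[OF norm_sum] sum_mono) (simp add: norm_mult)
    also have "\<dots> \<le> (\<Sum>w\<in>word_sphere n. \<Sum>v\<in>word_sphere j. cmod (x w) * cmod (\<xi> v) * (?C * real (card (splittings w v u))))"
      by (intro sum_mono mult_left_mono hecke_T_bound[OF fin] uC) (simp_all add: word_sphere_def)
    also have "\<dots> = ?C * ?s u" unfolding sum_distrib_left by (intro sum.cong refl) simp
    finally show ?thesis .
  qed
  have "(ell2_norm W ?f)\<^sup>2 = (\<Sum>u\<in>word_sphere i. (cmod (?f u))\<^sup>2)"
    by (rule ell2_norm_finite[OF finite_word_sphere[OF fin] sph]) (auto simp: sphere_proj_def word_sphere_def)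
  also have "\<dots> \<le> (\<Sum>u\<in>word_sphere i. (?C * ?s u)\<^sup>2)"
    using pt by (intro sum_mono power_mono) simp_all
  also have "\<dots> = ?C\<^sup>2 * (\<Sum>u\<in>word_sphere i. (?s u)\<^sup>2)"
    unfolding power_mult_distrib by (rule sum_distrib_left[symmetric])
  also have "\<dots> \<le> ?C\<^sup>2 * (?K\<^sup>2 * (\<Sum>w\<in>word_sphere n. (cmod (x w))\<^sup>2) * (\<Sum>v\<in>word_sphere j. (cmod (\<xi> v))\<^sup>2))"
    by (intro mult_left_mono splittings_bound[OF ns fin]) simp
  also have "(\<Sum>w\<in>word_sphere n. (cmod (x w))\<^sup>2) = (ell2_norm W x)\<^sup>2"
    using sup by (intro ell2_norm_finite[OF finite_word_sphere[OF fin] sph, symmetric]) auto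
  also have "?C\<^sup>2 * (?K\<^sup>2 * (ell2_norm W x)\<^sup>2 * (\<Sum>v\<in>word_sphere j. (cmod (\<xi> v))\<^sup>2)) \<le> ?C\<^sup>2 * (?K\<^sup>2 * (ell2_norm W x)\<^sup>2 * 1)"
  proof (intro mult_left_mono)
    have "(\<Sum>v\<in>word_sphere j. (cmod (\<xi> v))\<^sup>2) \<le> (ell2_norm W \<xi>)\<^sup>2"
      by (rule ell2_partial_sum[OF \<xi>(1) finite_word_sphere[OF fin] sph])
    also have "\<dots> \<le> 1" using \<xi>(2) ell2_norm_nonneg[of \<xi>] by (simp add: power_le_one)
    finally show "(\<Sum>v\<in>word_sphere j. (cmod (\<xi> v))\<^sup>2) \<le> 1" .
  qed simp_all
  also have "\<dots> = (?K * ?C * ell2_norm W x)\<^sup>2" unfolding power_mult_distrib by (simp only: mult_1_right ac_simps)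
  finally have sq: "(ell2_norm W ?f)\<^sup>2 \<le> (?K * ?C * ell2_norm W x)\<^sup>2" .
  have "0 \<le> ?K * ?C * ell2_norm W x" using C ell2_norm_nonneg[of x] by (intro mult_nonneg_nonneg) simp_all
  with sq have "ell2_norm W ?f \<le> ?K * ?C * ell2_norm W x" by (rule power2_le_imp_le)
  then show "ereal (ell2_norm W ?f) \<le> ereal (?K * ?C * ell2_norm W (hecke_op W S q x (delta \<one>)))"
    using hecke_op_delta_one[OF fin sup, of q] by simp
qed

section \<open>The flat of an induced square\<close>

text \<open>A letter lengthens a vector by at most one, and whenever it does not, the top degree is missed. Hence the
  component of top degree of \<open>T\<^sub>w \<delta>\<^sub>v\<close> is that of the group algebra, for all parameters.\<close>

lemma hecke_word_top:
  assumes l: "set l \<subseteq> S" and v: "v \<in> carrier W" and u: "u \<in> carrier W"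
  shows "length l + len v < len u \<Longrightarrow> hecke_word q l (delta v) u = 0"
    and "len u = length l + len v \<Longrightarrow> hecke_word q l (delta v) u = (if u = wp l \<otimes> v then 1 else 0)"
proof -
  have "(length l + len v < len u \<longrightarrow> hecke_word q l (delta v) u = 0) \<and>
     (len u = length l + len v \<longrightarrow> hecke_word q l (delta v) u = (if u = wp l \<otimes> v then 1 else 0))"
    using l u
  proof (induction l arbitrary: u)
    case Nil
    have "u \<noteq> v" if "len v < len u" using that by auto
    then show ?case using v by (simp add: delta_def)
  next
    case (Cons s l)
    have s: "s \<in> S" and lS: "set l \<subseteq> S" and u: "u \<in> carrier W" using Cons.prems by simp_all
    have su: "s \<otimes> u \<in> carrier W" using gen_in[OF s] u by simp
    have sse: "s \<otimes> (s \<otimes> u) = u" using gen_cancel[OF s u] .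
    have lu: "len u \<le> len (s \<otimes> u) + 1" using len_gen_mult[OF s su] sse by simp
    note IHu = Cons.IH[OF lS u] and IHsu = Cons.IH[OF lS su]
    show ?case
    proof (intro conjI impI)
      assume "length (s # l) + len v < len u"
      then have "length l + len v < len u" "length l + len v < len (s \<otimes> u)" using lu by simp_all
      then show "hecke_word q (s # l) (delta v) u = 0" using IHu IHsu by (simp add: hecke_word_Cons[OF u])
    next
      assume a: "len u = length (s # l) + len v"
      then have "hecke_word q l (delta v) u = 0" using IHu by simp
      then have e: "hecke_word q (s # l) (delta v) u = hecke_word q l (delta v) (s \<otimes> u)" by (simp add: hecke_word_Cons[OF u])
      have iff: "s \<otimes> u = wp l \<otimes> v \<longleftrightarrow> u = wp (s # l) \<otimes> v"
      proof -
        have "s \<otimes> (wp l \<otimes> v) = wp (s # l) \<otimes> v" using gen_in[OF s] wp_closed[OF lS] v by (simp add: m_assoc)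
        then show ?thesis using sse gen_cancel[OF s, of "wp l \<otimes> v"] wp_closed[OF lS] v by (metis m_closed)
      qed
      show "hecke_word q (s # l) (delta v) u = (if u = wp (s # l) \<otimes> v then 1 else 0)"
      proof (cases "len (s \<otimes> u) = length l + len v")
        case True
        then show ?thesis using IHsu e iff by simp
      next
        case False
        then have gt: "length l + len v < len (s \<otimes> u)" using lu a by simp
        have "len (wp l \<otimes> v) \<le> length l + len v"
          using len_mult[OF wp_closed[OF lS] v] len_le[OF lS] by simp
        then have "s \<otimes> u \<noteq> wp l \<otimes> v" using gt by auto
        then show ?thesis using IHsu gt e iff by simp
      qed
    qed
  qed
  then show "length l + len v < len u \<Longrightarrow> hecke_word q l (delta v) u = 0"
    "len u = length l + len v \<Longrightarrow> hecke_word q l (delta v) u = (if u = wp l \<otimes> v then 1 else 0)" by simp_all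
qed

lemma hecke_T_top:
  assumes "w \<in> carrier W" "v \<in> carrier W" "u \<in> carrier W" "len u = len w + len v"
  shows "hecke_T W S q w (delta v) u = (if u = w \<otimes> v then 1 else 0)"
proof -
  obtain l where l: "is_reduced l" "wp l = w" "hecke_T W S q w = hecke_word q l" using hecke_T_eq_hecke_word assms(1) .
  then show ?thesis using hecke_word_top(2)[of l v u q] assms by (simp add: is_reduced_def)
qed

lemma wp_alternating_even: "a \<in> S \<Longrightarrow> b \<in> S \<Longrightarrow> wp (alternating a b (2 * k)) = (a \<otimes> b) [^] k"
proof (induction k)
  case (Suc k)
  have e: "2 * Suc k = Suc (Suc (2 * k))" by simp
  have "wp (alternating a b (2 * Suc k)) = a \<otimes> b \<otimes> (a \<otimes> b) [^] k"
    unfolding e using Suc gen_in by (simp add: m_assoc)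
  also have "\<dots> = (a \<otimes> b) [^] Suc k" using nat_pow_Suc2[of "a \<otimes> b" k] Suc.prems gen_in by simp
  finally show ?case .
qed simp

context
  fixes s1 s2 s3 s4
  assumes sq: "s1 \<in> S" "s2 \<in> S" "s3 \<in> S" "s4 \<in> S" "m s1 s2 = 2" "m s2 s3 = 2" "m s3 s4 = 2" "m s4 s1 = 2"
    "m s1 s3 = \<infinity>" "m s2 s4 = \<infinity>"
begin

definition grid :: "nat \<Rightarrow> nat \<Rightarrow> 'a" where
  "grid k l = (s1 \<otimes> s3) [^] k \<otimes> (s2 \<otimes> s4) [^] l"

definition grid_word :: "nat \<Rightarrow> nat \<Rightarrow> 'a list" where
  "grid_word k l = alternating s1 s3 (2 * k) @ alternating s2 s4 (2 * l)"

lemma square_distinct: "s1 \<noteq> s2" "s1 \<noteq> s3" "s1 \<noteq> s4" "s2 \<noteq> s3" "s2 \<noteq> s4" "s3 \<noteq> s4"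
  using sq m_same m_two_neq by force+

lemma grid_word_in: "set (grid_word k l) \<subseteq> S"
  using alternating_in sq by (simp add: grid_word_def)

lemma wp_grid_word: "wp (grid_word k l) = grid k l"
  using alternating_in sq by (simp add: grid_word_def grid_def wp_append wp_alternating_even)

lemma grid_closed: "grid k l \<in> carrier W"
  using wp_closed[OF grid_word_in, of k l] by (simp add: wp_grid_word)

lemma grid_mult: "grid k l \<otimes> grid k' l' = grid (k + k') (l + l')"
proof -
  note [simp] = gen_in[OF sq(1)] gen_in[OF sq(2)] gen_in[OF sq(3)] gen_in[OF sq(4)]
  let ?A = "s1 \<otimes> s3" and ?B = "s2 \<otimes> s4"
  have c: "s1 \<otimes> s2 = s2 \<otimes> s1" "s2 \<otimes> s3 = s3 \<otimes> s2" "s3 \<otimes> s4 = s4 \<otimes> s3" "s4 \<otimes> s1 = s1 \<otimes> s4"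
    using sq gen_commute by blast+
  have "?A \<otimes> ?B = s1 \<otimes> (s3 \<otimes> s2) \<otimes> s4" by (simp add: m_assoc)
  also have "\<dots> = (s1 \<otimes> s2) \<otimes> (s3 \<otimes> s4)" unfolding c(2)[symmetric] by (simp add: m_assoc)
  also have "\<dots> = s2 \<otimes> (s1 \<otimes> s4) \<otimes> s3" unfolding c(1,3) by (simp add: m_assoc)
  also have "\<dots> = ?B \<otimes> ?A" unfolding c(4)[symmetric] by (simp add: m_assoc)
  finally have AB: "?A \<otimes> ?B = ?B \<otimes> ?A" .
  have "?B [^] l \<otimes> ?A = ?A \<otimes> ?B [^] l" using AB by (intro group_commutes_pow) simp_all
  then have "?A [^] k' \<otimes> ?B [^] l = ?B [^] l \<otimes> ?A [^] k'" by (intro group_commutes_pow) simp_all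
  then have comm: "?B [^] l \<otimes> ?A [^] k' = ?A [^] k' \<otimes> ?B [^] l" by simp
  have "grid k l \<otimes> grid k' l' = ?A [^] k \<otimes> (?B [^] l \<otimes> ?A [^] k') \<otimes> ?B [^] l'"
    by (simp add: grid_def m_assoc)
  also have "\<dots> = (?A [^] k \<otimes> ?A [^] k') \<otimes> (?B [^] l \<otimes> ?B [^] l')"
    unfolding comm by (simp add: m_assoc)
  finally show ?thesis by (simp add: grid_def nat_pow_mult)
qed

text \<open>The dihedral quotients for \<open>{s1, s3}\<close> and for \<open>{s2, s4}\<close> each ignore the other pair of letters, so every word of
  \<open>grid k l\<close> contains \<open>2 * k\<close> letters of the first and \<open>2 * l\<close> letters of the second kind.\<close>

lemma grid_counts:
  assumes w: "set w \<subseteq> S" "wp w = grid k l"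
  shows "2 * k \<le> length (filter (\<lambda>s. s \<in> {s1, s3}) w)" "2 * l \<le> length (filter (\<lambda>s. s \<in> {s2, s4}) w)"
proof -
  have fixed: "foldr (line a b) v x = x" if "set v \<inter> {a, b} = {}" for a b v x
    using that by (induction v) (auto simp: line_def)
  have set_alt: "set (alternating a b j) \<subseteq> {a, b}" for a b j
    by (induction j arbitrary: a b) force+
  have e: "wp w = wp (grid_word k l)" using w(2) by (simp add: wp_grid_word)
  obtain x where x: "foldr (line s1 s3) (alternating s1 s3 (2 * k)) x = x + int (2 * k)"
    using line_alternating_displacement[OF square_distinct(2)] by blast
  have "foldr (line s1 s3) (alternating s2 s4 (2 * l)) x = x"
    using set_alt[of s2 s4 "2 * l"] square_distinct by (intro fixed) auto
  then have "foldr (line s1 s3) w x = x + int (2 * k)"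
    using line_action[OF sq(1,3,9) w(1) grid_word_in e, of x] x by (simp add: grid_word_def)
  then show "2 * k \<le> length (filter (\<lambda>s. s \<in> {s1, s3}) w)"
    using line_displacement[of s1 s3 w x] by simp
  obtain y where y: "foldr (line s2 s4) (alternating s2 s4 (2 * l)) y = y + int (2 * l)"
    using line_alternating_displacement[OF square_distinct(5)] by blast
  have "foldr (line s2 s4) (alternating s1 s3 (2 * k)) z = z" for z
    using set_alt[of s1 s3 "2 * k"] square_distinct by (intro fixed) auto
  then have "foldr (line s2 s4) w y = y + int (2 * l)"
    using line_action[OF sq(2,4,10) w(1) grid_word_in e, of y] y by (simp add: grid_word_def)
  then show "2 * l \<le> length (filter (\<lambda>s. s \<in> {s2, s4}) w)"
    using line_displacement[of s2 s4 w y] by simp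
qed

lemma len_grid: "len (grid k l) = 2 * k + 2 * l"
proof (rule antisym)
  show "len (grid k l) \<le> 2 * k + 2 * l"
    using len_le[OF grid_word_in, of k l] by (simp add: wp_grid_word) (simp add: grid_word_def)
  obtain w where w: "is_reduced w" "wp w = grid k l" using reduced_word_ex[OF grid_closed] .
  have disj: "length (filter (\<lambda>s. s \<in> {s1, s3}) v) + length (filter (\<lambda>s. s \<in> {s2, s4}) v) \<le> length v" for v
    using square_distinct by (induction v) auto
  show "2 * k + 2 * l \<le> len (grid k l)"
    using grid_counts[of w k l] disj[of w] w by (simp add: is_reduced_def)
qed

lemma grid_inj:
  assumes "grid k l = grid k' l'"
  shows "k = k'"
proof -
  have le: "k \<le> k'" if "grid k l = grid k' l'" for k l k' l'
  proof -
    have cnt: "length (filter (\<lambda>s. s \<in> {a, b}) v) \<le> length v" for a b and v :: "'a list" by simp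
    have "set (alternating s2 s4 (2 * l')) \<inter> {s1, s3} = {}"
    proof -
      have "set (alternating a b j) \<subseteq> {a, b}" for a b :: 'a and j by (induction j arbitrary: a b) force+
      then have "set (alternating s2 s4 (2 * l')) \<subseteq> {s2, s4}" .
      then show ?thesis using square_distinct by auto
    qed
    then have "filter (\<lambda>s. s \<in> {s1, s3}) (alternating s2 s4 (2 * l')) = []" by (auto simp: filter_empty_conv)
    then have "length (filter (\<lambda>s. s \<in> {s1, s3}) (grid_word k' l')) \<le> 2 * k'"
      using cnt[of s1 s3 "alternating s1 s3 (2 * k')"] by (simp add: grid_word_def)
    then show ?thesis using grid_counts(1)[OF grid_word_in, of k' l' k l] that by (simp add: wp_grid_word)
  qed
  show ?thesis using le[OF assms] le[OF assms[symmetric]] by simp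
qed

text \<open>A segment of slope \<open>-1\<close> in the flat, all of whose points have the same length \<open>2 * r\<close>.\<close>

definition diagonal :: "nat \<Rightarrow> 'a set" where
  "diagonal r = (\<lambda>k. grid k (r - k)) ` {..r}"

lemma card_diagonal: "card (diagonal r) = Suc r"
  unfolding diagonal_def using grid_inj by (subst card_image) (auto simp: inj_on_def)

lemma finite_diagonal: "finite (diagonal r)"
  by (simp add: diagonal_def)

lemma diagonal_sphere: "diagonal r \<subseteq> word_sphere (2 * r)"
  by (auto simp: diagonal_def word_sphere_def len_grid grid_closed)

lemma diagonal_mult: "w \<in> diagonal r \<Longrightarrow> v \<in> diagonal r \<Longrightarrow> w \<otimes> v \<in> diagonal (2 * r)"
  unfolding diagonal_def
proof (elim imageE)
  fix k l assume "w = grid k (r - k)" "k \<in> {..r}" "v = grid l (r - l)" "l \<in> {..r}"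
  moreover from this have "(r - k) + (r - l) = 2 * r - (k + l)" by simp
  ultimately have "w \<otimes> v = grid (k + l) (2 * r - (k + l))" "k + l \<in> {..2 * r}"
    using grid_mult[of k "r - k" l "r - l"] by simp_all
  then show "w \<otimes> v \<in> (\<lambda>k. grid k (2 * r - k)) ` {..2 * r}" by blast
qed

text \<open>The test element is the sum of the \<open>T\<^sub>w\<close> over \<open>diagonal r\<close>, the test vector the normalised indicator
  function of \<open>diagonal r\<close>. The \<open>(r + 1)\<^sup>2\<close> products of two points of the segment are spread over the \<open>2 r + 1\<close> points of
  \<open>diagonal (2 * r)\<close>, hence the image has squared norm at least \<open>(r + 1)\<^sup>3 / (2 r + 1)\<close>.\<close>

lemma square_lower_bound:
  assumes fin: "finite S" and K: "K > 0"
    and bound: "\<And>i j n x. x \<in> chi W S n ` hecke_algebra W \<Longrightarrow>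
      op_norm W (sphere_proj W S i \<circ> hecke_op W S q x \<circ> sphere_proj W S j)
        \<le> ereal (K * ell2_norm W (hecke_op W S q x (delta \<one>)))"
  shows "real (Suc r) \<le> 2 * K\<^sup>2"
proof -
  let ?D = "diagonal r" and ?n = "2 * r" and ?i = "4 * r"
  define N where "N = real (Suc r)"
  have N: "N > 0" by (simp add: N_def)
  have sph: "word_sphere k \<subseteq> carrier W" for k by (auto simp: word_sphere_def)
  note D = diagonal_sphere[of r] and D2 = diagonal_sphere[of "2 * r"]
  have DC: "?D \<subseteq> carrier W" using D sph by blast
  define x :: "'a \<Rightarrow> complex" where "x w = (if w \<in> ?D then 1 else 0)" for w
  define \<xi> :: "'a \<Rightarrow> complex" where "\<xi> w = (if w \<in> ?D then complex_of_real (1 / sqrt N) else 0)" for w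
  have supp: "{w. x w \<noteq> 0} = ?D" by (auto simp: x_def)
  have "x \<in> hecke_algebra W" using supp DC finite_diagonal by (simp add: hecke_algebra_def)
  moreover have "chi W S ?n x = x"
  proof
    fix w show "chi W S ?n x w = x w"
      using D by (cases "w \<in> ?D") (auto simp: chi_def x_def word_sphere_def)
  qed
  ultimately have xin: "x \<in> chi W S ?n ` hecke_algebra W" by (metis imageI)
  have xs: "{w. x w \<noteq> 0} \<subseteq> word_sphere ?n" using supp D by simp
  have nx: "(ell2_norm W x)\<^sup>2 = N"
  proof -
    have "(ell2_norm W x)\<^sup>2 = (\<Sum>v\<in>?D. (cmod (x v))\<^sup>2)"
      by (rule ell2_norm_finite[OF finite_diagonal DC]) (simp add: x_def)
    then show ?thesis by (simp add: x_def card_diagonal N_def)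
  qed
  have n\<xi>: "(ell2_norm W \<xi>)\<^sup>2 = 1"
  proof -
    have "(ell2_norm W \<xi>)\<^sup>2 = (\<Sum>v\<in>?D. (cmod (\<xi> v))\<^sup>2)"
      by (rule ell2_norm_finite[OF finite_diagonal DC]) (simp add: \<xi>_def)
    also have "\<dots> = (\<Sum>v\<in>?D. 1 / N)"
      using N by (intro sum.cong refl) (simp add: \<xi>_def norm_divide power_divide)
    finally show ?thesis using N by (simp add: card_diagonal N_def)
  qed
  have "(\<lambda>w. (cmod (\<xi> w))\<^sup>2) summable_on carrier W"
  proof -
    have "(\<lambda>w. (cmod (\<xi> w))\<^sup>2) summable_on ?D" using finite_diagonal by simp
    then show ?thesis by (rule summable_on_cong_neutral[THEN iffD1, rotated -1]) (use DC in \<open>auto simp: \<xi>_def\<close>)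
  qed
  then have \<xi>in: "\<xi> \<in> ell2 W" using DC by (auto simp: ell2_def \<xi>_def)
  have n\<xi>1: "ell2_norm W \<xi> \<le> 1" using n\<xi> ell2_norm_nonneg[of \<xi>] by (simp add: power2_eq_1_iff)
  let ?f = "(sphere_proj W S ?i \<circ> hecke_op W S q x \<circ> sphere_proj W S ?n) \<xi>"
  have "ereal (ell2_norm W ?f) \<le> op_norm W (sphere_proj W S ?i \<circ> hecke_op W S q x \<circ> sphere_proj W S ?n)"
    unfolding op_norm_def using \<xi>in n\<xi>1 by (intro SUP_upper) simp
  also have "\<dots> \<le> ereal (K * ell2_norm W (hecke_op W S q x (delta \<one>)))" using bound[OF xin] .
  finally have "ell2_norm W ?f \<le> K * ell2_norm W x"
    unfolding hecke_op_delta_one[OF fin xs] by simp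
  then have "(ell2_norm W ?f)\<^sup>2 \<le> (K * ell2_norm W x)\<^sup>2"
    using ell2_norm_nonneg by (intro power_mono)
  then have upper: "(ell2_norm W ?f)\<^sup>2 \<le> K\<^sup>2 * N" by (simp add: power_mult_distrib nx)
  \<comment> \<open>On \<open>diagonal (2 * r)\<close> the image is the convolution of the two indicator functions, up to normalisation.\<close>
  define h where "h u = (\<Sum>w\<in>?D. \<Sum>v\<in>?D. if u = w \<otimes> v then 1 / sqrt N else 0)" for u
  have fh: "?f u = complex_of_real (h u)" if u: "u \<in> diagonal (2 * r)" for u
  proof -
    have uC: "u \<in> carrier W" and ul: "len u = 4 * r" using u D2 by (auto simp: word_sphere_def)
    have "?f u = (\<Sum>w\<in>word_sphere ?n. \<Sum>v\<in>word_sphere ?n. x w * \<xi> v * hecke_T W S q w (delta v) u)"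
      using hecke_op_sphere_proj[OF fin xs uC, of q ?n \<xi>] uC ul by (simp add: sphere_proj_def)
    also have "\<dots> = (\<Sum>w\<in>word_sphere ?n. \<Sum>v\<in>?D. x w * \<xi> v * hecke_T W S q w (delta v) u)"
      using D finite_word_sphere[OF fin] by (intro sum.cong refl sum.mono_neutral_right) (auto simp: \<xi>_def)
    also have "\<dots> = (\<Sum>w\<in>?D. \<Sum>v\<in>?D. x w * \<xi> v * hecke_T W S q w (delta v) u)"
      using D finite_word_sphere[OF fin] by (intro sum.mono_neutral_right) (auto simp: x_def)
    also have "\<dots> = (\<Sum>w\<in>?D. \<Sum>v\<in>?D. complex_of_real (if u = w \<otimes> v then 1 / sqrt N else 0))"
    proof (intro sum.cong refl)
      fix w v assume wv: "w \<in> ?D" "v \<in> ?D"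
      then have "w \<in> carrier W" "v \<in> carrier W" "len w = 2 * r" "len v = 2 * r" using D by (auto simp: word_sphere_def)
      then have "hecke_T W S q w (delta v) u = (if u = w \<otimes> v then 1 else 0)"
        using uC ul by (intro hecke_T_top) simp_all
      then show "x w * \<xi> v * hecke_T W S q w (delta v) u = complex_of_real (if u = w \<otimes> v then 1 / sqrt N else 0)"
        using wv by (simp add: x_def \<xi>_def)
    qed
    finally show ?thesis by (simp add: h_def)
  qed
  have "(\<Sum>u\<in>diagonal (2 * r). h u) = (\<Sum>w\<in>?D. \<Sum>v\<in>?D. \<Sum>u\<in>diagonal (2 * r). if u = w \<otimes> v then 1 / sqrt N else 0)"
    unfolding h_def by (subst sum.swap) (intro sum.cong refl sum.swap)
  also have "\<dots> = (\<Sum>w\<in>?D. \<Sum>v\<in>?D. 1 / sqrt N)"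
    using diagonal_mult finite_diagonal by (intro sum.cong refl) simp
  also have "\<dots> = N * N / sqrt N" by (simp add: card_diagonal N_def)
  finally have "(\<Sum>u\<in>diagonal (2 * r). h u)\<^sup>2 = N ^ 3"
    using N by (simp add: power_divide power_mult_distrib power2_eq_square power3_eq_cube)
  then have "N ^ 3 \<le> (\<Sum>u\<in>diagonal (2 * r). (h u)\<^sup>2) * card (diagonal (2 * r))"
    using sum_squared_le_sum_of_squares[of h "diagonal (2 * r)"] by simp
  also have "\<dots> \<le> (\<Sum>u\<in>diagonal (2 * r). (h u)\<^sup>2) * (2 * N)"
    by (intro mult_left_mono sum_nonneg) (simp_all add: card_diagonal N_def)
  finally have lower: "N ^ 3 \<le> (\<Sum>u\<in>diagonal (2 * r). (h u)\<^sup>2) * (2 * N)" .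
  have "(\<Sum>u\<in>diagonal (2 * r). (h u)\<^sup>2) = (\<Sum>u\<in>diagonal (2 * r). (cmod (?f u))\<^sup>2)"
    by (rule sum.cong[OF refl]) (simp only: fh norm_of_real power2_abs)
  also have "\<dots> \<le> (\<Sum>u\<in>word_sphere ?i. (cmod (?f u))\<^sup>2)"
    using D2 finite_word_sphere[OF fin] by (intro sum_mono2) simp_all
  also have "\<dots> = (ell2_norm W ?f)\<^sup>2"
    by (rule ell2_norm_finite[OF finite_word_sphere[OF fin] sph, symmetric]) (auto simp: sphere_proj_def word_sphere_def)
  also have "\<dots> \<le> K\<^sup>2 * N" by (rule upper)
  finally have "(\<Sum>u\<in>diagonal (2 * r). (h u)\<^sup>2) * (2 * N) \<le> K\<^sup>2 * N * (2 * N)"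
    using N by (intro mult_right_mono) simp_all
  with lower have "N ^ 3 \<le> K\<^sup>2 * N * (2 * N)" by (rule order_trans)
  then have "N * N\<^sup>2 \<le> (2 * K\<^sup>2) * N\<^sup>2" by (simp add: power3_eq_cube power2_eq_square ac_simps)
  then show ?thesis using N by (simp add: N_def)
qed

end

end

section \<open>Characterisation by induced squares\<close>

theorem theorem1:
  fixes W :: "('a, 'b) monoid_scheme" and S :: "'a set" and m :: "'a \<Rightarrow> 'a \<Rightarrow> enat"
  assumes "coxeter_system W S m" and "finite S" and "right_angled S m"
  shows "(\<not> has_induced_square S m \<longrightarrow>
      (\<exists>K::real. K > 0 \<and>
        (\<forall>q\<in>hecke_params W S. \<forall>i j n. \<forall>x\<in>chi W S n ` hecke_algebra W.
          op_norm W (sphere_proj W S i \<circ> hecke_op W S q x \<circ> sphere_proj W S j)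
            \<le> ereal (K * hecke_const S m q * ell2_norm W (hecke_op W S q x (delta \<one>\<^bsub>W\<^esub>))))))
    \<and> (has_induced_square S m \<longrightarrow>
      (\<forall>q\<in>hecke_params W S. \<not> (\<exists>K::real. K > 0 \<and>
        (\<forall>i j n. \<forall>x\<in>chi W S n ` hecke_algebra W.
          op_norm W (sphere_proj W S i \<circ> hecke_op W S q x \<circ> sphere_proj W S j)
            \<le> ereal (K * ell2_norm W (hecke_op W S q x (delta \<one>\<^bsub>W\<^esub>)))))))"
proof (intro conjI impI ballI notI)
  interpret racg W S m
    by (intro racg.intro racg_axioms.intro coxeter_systemD(1)[OF assms(1)] assms)
  {
    assume ns: "\<not> has_induced_square S m"
    let ?K = "real (card clique_words) * real fork_bound ^ 2"
    have "card clique_words > 0"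
      using finite_clique_words[OF assms(2)] empty_clique_word card_gt_0_iff by blast
    then have "?K > 0" using fork_bound_pos[OF assms(2)] by simp
    then show "\<exists>K::real. K > 0 \<and>
        (\<forall>q\<in>hecke_params W S. \<forall>i j n. \<forall>x\<in>chi W S n ` hecke_algebra W.
          op_norm W (sphere_proj W S i \<circ> hecke_op W S q x \<circ> sphere_proj W S j)
            \<le> ereal (K * hecke_const S m q * ell2_norm W (hecke_op W S q x (delta \<one>\<^bsub>W\<^esub>))))"
      by (intro exI[of _ ?K] conjI ballI allI haagerup_inequality[OF ns assms(2)])
  next
    fix q
    assume "has_induced_square S m"
    then obtain s1 s2 s3 s4 where
      sq: "s1 \<in> S" "s2 \<in> S" "s3 \<in> S" "s4 \<in> S" "m s1 s2 = 2" "m s2 s3 = 2" "m s3 s4 = 2" "m s4 s1 = 2"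
        "m s1 s3 = \<infinity>" "m s2 s4 = \<infinity>"
      unfolding has_induced_square_def by blast
    assume "\<exists>K::real. K > 0 \<and>
        (\<forall>i j n. \<forall>x\<in>chi W S n ` hecke_algebra W.
          op_norm W (sphere_proj W S i \<circ> hecke_op W S q x \<circ> sphere_proj W S j)
            \<le> ereal (K * ell2_norm W (hecke_op W S q x (delta \<one>\<^bsub>W\<^esub>))))"
    then obtain K :: real where K: "K > 0"
      and bound: "\<forall>i j n. \<forall>x\<in>chi W S n ` hecke_algebra W.
        op_norm W (sphere_proj W S i \<circ> hecke_op W S q x \<circ> sphere_proj W S j)
          \<le> ereal (K * ell2_norm W (hecke_op W S q x (delta \<one>\<^bsub>W\<^esub>)))"
      by (elim exE conjE)
    obtain r :: nat where "2 * K\<^sup>2 < real r" using reals_Archimedean2 by blast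
    moreover have "real (Suc r) \<le> 2 * K\<^sup>2"
      by (rule square_lower_bound[OF sq assms(2) K, of q]) (rule bound[rule_format])
    ultimately show False by simp
  }
qed

end
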